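(* Let $p$ be a monic free $d\times d$ matrix polynomial in $x=(x_1,\dots,x_g)$ and $x^*=(x_1^*,\dots,x_g^* )$. Then $p$ is invariant under coordinate unitary conjugation if and only if there exist a unitary $V\in M_d(\mathbb C)$ and free square matrix polynomials $p_1,\dots,p_g$, where $p_i$ involves only the variables $x_i,x_i^*$ and the sizes of the $p_i$ (some possibly $0$) add up to $d$, such that $$V^*p(x)V=p_1(x_1)\oplus\cdots\oplus p_g(x_g).$$
   Context: Words are elements of the free monoid $\langle x,x^*\rangle$ on the $2g$ noncommuting letters $x_1,\dots,x_g,x_1^*,\dots,x_g^*$. A free $d\times d$ matrix polynomial is a finite sum $p(x)=\sum_w B_w w(x)$ with $B_w\in M_d(\mathbb C)$ and $w$ words. For $X\in M_n(\mathbb C)^g$ its evaluation is $p(X)=\sum_w B_w\otimes w(X)\in M_d(\mathbb C)\otimes M_n(\mathbb C)$, where $w(X)$ is obtained by replacing $x_i$ by $X_i$, $x_i^*$ by the adjoint $X_i^*$, and the empty word by $I_n$. $p$ is monic if $p(0)=I_d$, i.e., the coefficient of the empty word is $I_d$. $p$ is invariant under coordinate unitary conjugation if for every $n$ and every $g$-tuple of unitaries $U=(U_1,\dots,U_g)\in M_n(\mathbb C)^g$ there exists a unitary $W\in M_{dn}(\mathbb C)$ such that for all $X\in M_n(\mathbb C)^g$, $p(U_1^*X_1U_1,\dots,U_g^*X_gU_g)=W^*p(X)W$. *)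

theory Defs
  imports Complex_Main "Jordan_Normal_Form.Schur_Decomposition"
begin

text \<open>Variables are numbered from \<open>0\<close>: \<open>Var i\<close> stands for \<open>x_(i+1)\<close> and \<open>Adj i\<close> for its
  formal adjoint. Words are lists of letters, the unit of the free monoid being \<open>[]\<close>.\<close>

datatype letter = Var nat | Adj nat

fun letter_index :: "letter \<Rightarrow> nat" where
  "letter_index (Var i) = i"
| "letter_index (Adj i) = i"

definition words_in :: "nat set \<Rightarrow> letter list set" where
  "words_in I = {w. letter_index ` set w \<subseteq> I}"

text \<open>A polynomial is its coefficient function; the size \<open>d\<close> is explicit because the zero
  matrix is size dependent, and \<open>d = 0\<close> is allowed.\<close>

type_synonym free_poly = "letter list \<Rightarrow> complex mat"

definition poly_support :: "nat \<Rightarrow> free_poly \<Rightarrow> letter list set" where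
  "poly_support d p = {w. p w \<noteq> 0\<^sub>m d d}"

definition free_mat_poly :: "nat set \<Rightarrow> nat \<Rightarrow> free_poly \<Rightarrow> bool" where
  "free_mat_poly I d p \<longleftrightarrow>
     (\<forall>w. p w \<in> carrier_mat d d) \<and> finite (poly_support d p) \<and> poly_support d p \<subseteq> words_in I"

definition monic_poly :: "nat \<Rightarrow> free_poly \<Rightarrow> bool" where
  "monic_poly d p \<longleftrightarrow> p [] = 1\<^sub>m d"

definition unitary_mat :: "nat \<Rightarrow> complex mat \<Rightarrow> bool" where
  "unitary_mat n U \<longleftrightarrow>
     U \<in> carrier_mat n n \<and> mat_adjoint U * U = 1\<^sub>m n \<and> U * mat_adjoint U = 1\<^sub>m n"

definition kron :: "complex mat \<Rightarrow> complex mat \<Rightarrow> complex mat" where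
  "kron A B = mat (dim_row A * dim_row B) (dim_col A * dim_col B)
     (\<lambda>(i, j). A $$ (i div dim_row B, j div dim_col B) * B $$ (i mod dim_row B, j mod dim_col B))"

fun letter_eval :: "(nat \<Rightarrow> complex mat) \<Rightarrow> letter \<Rightarrow> complex mat" where
  "letter_eval X (Var i) = X i"
| "letter_eval X (Adj i) = mat_adjoint (X i)"

fun word_eval :: "nat \<Rightarrow> (nat \<Rightarrow> complex mat) \<Rightarrow> letter list \<Rightarrow> complex mat" where
  "word_eval n X [] = 1\<^sub>m n"
| "word_eval n X (l # w) = letter_eval X l * word_eval n X w"

text \<open>The finite sum of the matrices \<open>kron (p w) (w(X))\<close> is taken entrywise, since
  \<open>complex mat\<close> has no zero common to all sizes.\<close>

definition poly_eval :: "nat \<Rightarrow> nat \<Rightarrow> free_poly \<Rightarrow> (nat \<Rightarrow> complex mat) \<Rightarrow> complex mat" where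
  "poly_eval d n p X = mat (d * n) (d * n)
     (\<lambda>ij. \<Sum>w\<in>poly_support d p. kron (p w) (word_eval n X w) $$ ij)"

text \<open>Only the entries \<open>X 0, \<dots>, X (g - 1)\<close> of a tuple matter.\<close>

definition coord_unitary_invariant :: "nat \<Rightarrow> nat \<Rightarrow> free_poly \<Rightarrow> bool" where
  "coord_unitary_invariant g d p \<longleftrightarrow>
     (\<forall>n U. (\<forall>i<g. unitary_mat n (U i)) \<longrightarrow>
       (\<exists>W. unitary_mat (d * n) W \<and>
         (\<forall>X. (\<forall>i<g. X i \<in> carrier_mat n n) \<longrightarrow>
           poly_eval d n p (\<lambda>i. mat_adjoint (U i) * X i * U i)
             = mat_adjoint W * poly_eval d n p X * W)))"

definition poly_conj :: "complex mat \<Rightarrow> free_poly \<Rightarrow> free_poly" where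
  "poly_conj V p = (\<lambda>w. mat_adjoint V * p w * V)"

definition poly_direct_sum :: "nat \<Rightarrow> (nat \<Rightarrow> free_poly) \<Rightarrow> free_poly" where
  "poly_direct_sum g q = (\<lambda>w. diag_block_mat (map (\<lambda>i. q i w) [0..<g]))"

end

theory Submission
  imports Defs
begin

text \<open>The unitary \<open>W\<close> attached to \<open>U\<close> does not depend on \<open>X\<close>, so it conjugates every part of \<open>p\<close>
  that is homogeneous with respect to some grading of the words, and products of values of such
  parts (or their adjoints) at different tuples vanish before the change of coordinates if and only
  if they vanish after it. Evaluating at tuples of partial permutation matrices that spell a single
  word along a path isolates its coefficient. If the word involves two different indices, moving the
  edges with one of these indices away from the path kills its homogeneous part, so the coefficient
  is zero. If \<open>v\<close> and \<open>w\<close> are words in \<open>x\<^sub>i\<close> and in \<open>x\<^sub>j\<close>, the corresponding paths can be disjoint,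
  where the product vanishes, or be moved to share one end point, where it contains
  \<open>B\<^sub>v B\<^sub>w\<close> (or a variant with adjoints); hence all these products are zero. The ranges of the
  coefficients and of their adjoints are thus orthogonal for different indices, and an orthonormal
  basis adapted to them yields \<open>V\<close>.\<close>

text \<open>Nothing is known about \<open>W\<close> except that it is unitary, so only statements
  that survive a unitary change of basis can be exploited; this is why the argument runs on the
  vanishing of matrices and of their products. A path can also be walked back and forth: for the
  word \<open>x\<close> on one edge, \<open>x x^* x\<close> joins the same end points. Fixing the
  length of the words removes these competitors. All four products of \<open>B_v\<close> or its
  adjoint with \<open>B_w\<close> or its adjoint are needed. The subspace of an index must contain
  the ranges of its coefficients and of their adjoints, since otherwise it would not reduce the
  coefficients; orthogonality of two such subspaces amounts to exactly these four products being
  zero. For the converse, in the basis given by \<open>V\<close> each coordinate of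
  \<open>M_d\<close> belongs to one block, hence to one variable. Acting over that coordinate by the
  unitary of this variable, and changing the basis back, gives \<open>W\<close> explicitly.\<close>

section \<open>Adjoints, unitary matrices and Kronecker products\<close>

lemma dim_mat_adjoint [simp]:
  "dim_row (mat_adjoint A) = dim_col A" "dim_col (mat_adjoint A) = dim_row A"
  by (simp_all add: mat_adjoint_def)

lemma mat_adjoint_carrier [simp]:
  "mat_adjoint A \<in> carrier_mat m n \<longleftrightarrow> A \<in> carrier_mat n m"
  unfolding carrier_mat_def mem_Collect_eq dim_mat_adjoint by (rule conj_commute)

lemma index_mat_adjoint [simp]:
  fixes A :: "complex mat"
  assumes "i < dim_col A" "j < dim_row A"
  shows "mat_adjoint A $$ (i, j) = cnj (A $$ (j, i))"
  using assms by (simp add: mat_adjoint_def mat_of_rows_def)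

lemma mat_adjoint_adjoint [simp]: "mat_adjoint (mat_adjoint A) = (A :: complex mat)"
  by (rule eq_matI) auto

lemma index_mult_mat_sum:
  assumes "A \<in> carrier_mat m n" "B \<in> carrier_mat n l" "i < m" "j < l"
  shows "(A * B) $$ (i, j) = (\<Sum>k<n. A $$ (i, k) * B $$ (k, j))"
  using assms by (auto simp: scalar_prod_def atLeast0LessThan intro!: sum.cong)

lemma mat_adjoint_mult:
  assumes "A \<in> carrier_mat m n" "B \<in> carrier_mat n l"
  shows "mat_adjoint (A * B) = mat_adjoint B * (mat_adjoint A :: complex mat)"
proof (rule eq_matI)
  fix i j assume "i < dim_row (mat_adjoint B * mat_adjoint A)"
    and "j < dim_col (mat_adjoint B * mat_adjoint A)"
  then have ij: "i < l" "j < m" using assms by auto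
  then have "mat_adjoint (A * B) $$ (i, j) = cnj ((A * B) $$ (j, i))"
    using assms by (subst index_mat_adjoint) auto
  also have "\<dots> = (\<Sum>k<n. cnj (A $$ (j, k)) * cnj (B $$ (k, i)))"
    using assms ij by (simp add: index_mult_mat_sum[of A m n B l] del: index_mult_mat)
  also have "\<dots> = (mat_adjoint B * mat_adjoint A) $$ (i, j)"
    using assms ij
    by (subst index_mult_mat_sum[of _ l n _ m]) (auto intro!: sum.cong)
  finally show "mat_adjoint (A * B) $$ (i, j) = (mat_adjoint B * mat_adjoint A) $$ (i, j)" .
qed (use assms in auto)

lemma mat_adjoint_one [simp]: "mat_adjoint (1\<^sub>m n) = (1\<^sub>m n :: complex mat)"
  by (rule eq_matI) auto

lemma mat_adjoint_zero [simp]: "mat_adjoint (0\<^sub>m m n) = (0\<^sub>m n m :: complex mat)"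
  by (rule eq_matI) auto

lemma unitary_mat_one [simp]: "unitary_mat n (1\<^sub>m n)"
  by (simp add: unitary_mat_def)

lemma unitary_mat_adjoint: "unitary_mat n U \<Longrightarrow> unitary_mat n (mat_adjoint U)"
  by (simp add: unitary_mat_def)

lemma unitary_cancel:
  assumes "unitary_mat n U" "A \<in> carrier_mat n m"
  shows "U * (mat_adjoint U * A) = A" "mat_adjoint U * (U * A) = A"
proof -
  have U: "U \<in> carrier_mat n n" "mat_adjoint U \<in> carrier_mat n n"
    using assms(1) by (auto simp: unitary_mat_def)
  show "U * (mat_adjoint U * A) = A" "mat_adjoint U * (U * A) = A"
    using assms assoc_mult_mat[OF U(1,2), of A m] assoc_mult_mat[OF U(2,1), of A m]
    by (auto simp: unitary_mat_def)
qed

lemma unitary_mat_mult: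
  assumes "unitary_mat n U" "unitary_mat n V"
  shows "unitary_mat n (U * V)"
proof -
  have c: "U \<in> carrier_mat n n" "V \<in> carrier_mat n n" "mat_adjoint U \<in> carrier_mat n n" 
      "mat_adjoint V \<in> carrier_mat n n"
    using assms by (auto simp: unitary_mat_def)
  have adj: "mat_adjoint (U * V) = mat_adjoint V * mat_adjoint U"
    using c by (intro mat_adjoint_mult)
  have "mat_adjoint V * mat_adjoint U * (U * V) = mat_adjoint V * (mat_adjoint U * (U * V))"
    by (rule assoc_mult_mat) (use c in auto)
  moreover have "U * V * (mat_adjoint V * mat_adjoint U) = U * (V * (mat_adjoint V * mat_adjoint U))"
    by (rule assoc_mult_mat) (use c in auto)
  ultimately show ?thesis
    using assms c unfolding unitary_mat_def adj
    by (auto simp: unitary_cancel[OF assms(1)] unitary_cancel[OF assms(2)])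
qed

section \<open>Kronecker products through block indices \<open>a * n + r\<close>\<close>

lemma block_index_less:
  fixes a r d n :: nat
  assumes "a < d" "r < n" shows "a * n + r < d * n"
proof -
  have "a * n + r < Suc a * n" using assms by simp
  also have "\<dots> \<le> d * n" using assms by (intro mult_le_mono1) simp
  finally show ?thesis .
qed

lemma block_index_eq_iff:
  fixes a b r s n :: nat
  assumes "r < n" "s < n" shows "a * n + r = b * n + s \<longleftrightarrow> a = b \<and> r = s"
proof
  assume h: "a * n + r = b * n + s"
  have "(a * n + r) div n = (b * n + s) div n" "(a * n + r) mod n = (b * n + s) mod n"
    using h by simp_all
  then show "a = b \<and> r = s" using assms by simp
qed simp

text \<open>Turns a flat index into the pair of a block and a position, so that later computations
  with \<open>kron\<close> need neither \<open>div\<close> nor \<open>mod\<close>.\<close>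

lemma block_indexE:
  fixes i d n :: nat
  assumes "i < d * n" obtains a r where "a < d" "r < n" "i = a * n + r"
proof (rule that)
  show "i = i div n * n + i mod n" by simp
  show "i div n < d" using assms by (simp add: less_mult_imp_div_less)
  show "i mod n < n" using assms by (cases n) auto
qed

lemma sum_block:
  fixes f :: "nat \<Rightarrow> 'a :: comm_monoid_add"
  shows "(\<Sum>i<d * n. f i) = (\<Sum>a<d. \<Sum>r<n. f (a * n + r))"
proof -
  have "(\<Sum>r<n. f (a * n + r)) = sum f {a * n..<a * n + n}" for a
    using sum.shift_bounds_nat_ivl[of f 0 "a * n" n] by (simp add: atLeast0LessThan add.commute)
  then show ?thesis by (simp add: sum.nat_group)
qed

lemma block_mat_eqI:
  assumes "A \<in> carrier_mat (d * n) (e * m)" "B \<in> carrier_mat (d * n) (e * m)"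
    and "\<And>a r b s. a < d \<Longrightarrow> r < n \<Longrightarrow> b < e \<Longrightarrow> s < m \<Longrightarrow>
      A $$ (a * n + r, b * m + s) = B $$ (a * n + r, b * m + s)"
  shows "A = B"
proof (rule eq_matI)
  fix i j assume "i < dim_row B" "j < dim_col B"
  then have "i < d * n" "j < e * m" using assms by auto
  then show "A $$ (i, j) = B $$ (i, j)"
    by (elim block_indexE) (use assms in auto)
qed (use assms in auto)

lemma kron_carrier [simp]:
  assumes "A \<in> carrier_mat d e" "B \<in> carrier_mat n m"
  shows "kron A B \<in> carrier_mat (d * n) (e * m)"
  using assms by (auto simp: kron_def)

lemma index_kron:
  assumes "A \<in> carrier_mat d e" "B \<in> carrier_mat n m" "a < d" "r < n" "b < e" "s < m"
  shows "kron A B $$ (a * n + r, b * m + s) = A $$ (a, b) * B $$ (r, s)"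
  using assms by (simp add: kron_def block_index_less)

lemma kron_mult:
  assumes "A \<in> carrier_mat d e" "B \<in> carrier_mat n m" "C \<in> carrier_mat e f" "D \<in> carrier_mat m l"
  shows "kron A B * kron C D = kron (A * C) (B * D)"
proof (rule block_mat_eqI)
  show "kron A B * kron C D \<in> carrier_mat (d * n) (f * l)"
    by (rule mult_carrier_mat[OF kron_carrier[OF assms(1,2)] kron_carrier[OF assms(3,4)]])
  show "kron (A * C) (B * D) \<in> carrier_mat (d * n) (f * l)"
    using assms by (intro mult_carrier_mat kron_carrier)
  fix a r b s assume i: "a < d" "r < n" "b < f" "s < l"
  have "(kron A B * kron C D) $$ (a * n + r, b * l + s) =
      (\<Sum>k<e * m. kron A B $$ (a * n + r, k) * kron C D $$ (k, b * l + s))"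
    by (rule index_mult_mat_sum[OF kron_carrier[OF assms(1,2)] kron_carrier[OF assms(3,4)]
        block_index_less[OF i(1,2)] block_index_less[OF i(3,4)]])
  also have "\<dots> = (\<Sum>c<e. \<Sum>t<m. (A $$ (a, c) * B $$ (r, t)) * (C $$ (c, b) * D $$ (t, s)))"
    unfolding sum_block
    by (intro sum.cong refl arg_cong2[of _ _ _ _ "(*)"] index_kron[OF assms(1,2)] index_kron[OF assms(3,4)])
      (use i in auto)
  also have "\<dots> = (\<Sum>c<e. A $$ (a, c) * C $$ (c, b)) * (\<Sum>t<m. B $$ (r, t) * D $$ (t, s))"
    by (simp add: sum_product mult_ac)
  also have "\<dots> = (A * C) $$ (a, b) * (B * D) $$ (r, s)"
    using i by (simp only: index_mult_mat_sum[OF assms(1,3)] index_mult_mat_sum[OF assms(2,4)])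
  also have "\<dots> = kron (A * C) (B * D) $$ (a * n + r, b * l + s)"
    using i assms by (intro index_kron[symmetric]) auto
  finally show "(kron A B * kron C D) $$ (a * n + r, b * l + s) =
    kron (A * C) (B * D) $$ (a * n + r, b * l + s)" .
qed

lemma kron_adjoint:
  assumes "A \<in> carrier_mat d e" "B \<in> carrier_mat n m"
  shows "mat_adjoint (kron A B) = kron (mat_adjoint A) (mat_adjoint B)"
proof (rule block_mat_eqI)
  show "mat_adjoint (kron A B) \<in> carrier_mat (e * m) (d * n)"
    using assms by simp
  show "kron (mat_adjoint A) (mat_adjoint B) \<in> carrier_mat (e * m) (d * n)"
    using assms by simp
  fix a r b s assume i: "a < e" "r < m" "b < d" "s < n"
  have "mat_adjoint (kron A B) $$ (a * m + r, b * n + s) = cnj (kron A B $$ (b * n + s, a * m + r))"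
    using i carrier_matD[OF kron_carrier[OF assms]]
    by (intro index_mat_adjoint) (simp_all add: block_index_less)
  also have "\<dots> = kron (mat_adjoint A) (mat_adjoint B) $$ (a * m + r, b * n + s)"
    using i assms by (subst (1 2) index_kron) auto
  finally show "mat_adjoint (kron A B) $$ (a * m + r, b * n + s) =
      kron (mat_adjoint A) (mat_adjoint B) $$ (a * m + r, b * n + s)" .
qed

lemma kron_one: "kron (1\<^sub>m d) (1\<^sub>m n) = 1\<^sub>m (d * n)"
proof (rule block_mat_eqI[of _ d n d n])
  fix a r b s assume i: "a < d" "r < n" "b < d" "s < n"
  then show "kron (1\<^sub>m d) (1\<^sub>m n) $$ (a * n + r, b * n + s) = 1\<^sub>m (d * n) $$ (a * n + r, b * n + s)"
    by (subst index_kron) (auto simp: block_index_less block_index_eq_iff)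
qed auto

lemma unitary_kron:
  assumes "unitary_mat d V" "unitary_mat n U" shows "unitary_mat (d * n) (kron V U)"
proof -
  have c: "V \<in> carrier_mat d d" "U \<in> carrier_mat n n"
      "mat_adjoint V \<in> carrier_mat d d" "mat_adjoint U \<in> carrier_mat n n"
    using assms by (auto simp: unitary_mat_def)
  show ?thesis
    using assms c unfolding unitary_mat_def
    by (simp add: kron_adjoint[OF c(1,2)] kron_mult[OF c(1,2,3,4)] kron_mult[OF c(3,4,1,2)] kron_one)
qed

section \<open>Orthonormal bases adapted to orthogonal subspaces\<close>

text \<open>Applied twice it yields the span of a set of vectors in finite dimension; membership in
  a span is thus expressed by orthogonality alone, without linear combinations.\<close>

definition orthc :: "nat \<Rightarrow> complex vec set \<Rightarrow> complex vec set" where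
  "orthc d G = {y \<in> carrier_vec d. \<forall>z\<in>G. z \<bullet>c y = 0}"

definition orthonormal :: "nat \<Rightarrow> complex vec set \<Rightarrow> bool" where
  "orthonormal d S \<longleftrightarrow> S \<subseteq> carrier_vec d \<and> (\<forall>x\<in>S. \<forall>y\<in>S. x \<bullet>c y = (if x = y then 1 else 0))"

lemma cscalar_prod_sum:
  fixes x y :: "complex vec"
  shows "y \<in> carrier_vec d \<Longrightarrow> x \<bullet>c y = (\<Sum>k<d. x $ k * cnj (y $ k))"
  by (auto simp: scalar_prod_def atLeast0LessThan intro!: sum.cong)

lemma cscalar_prod_swap:
  fixes x y :: "complex vec"
  assumes "x \<in> carrier_vec d" "y \<in> carrier_vec d"
  shows "x \<bullet>c y = cnj (y \<bullet>c x)"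
  by (simp add: cscalar_prod_sum[OF assms(1)] cscalar_prod_sum[OF assms(2)] mult.commute)

lemma cscalar_prod_eq_0_swap:
  fixes x y :: "complex vec"
  assumes "x \<in> carrier_vec d" "y \<in> carrier_vec d"
  shows "x \<bullet>c y = 0 \<longleftrightarrow> y \<bullet>c x = 0"
  by (simp add: cscalar_prod_swap[OF assms])

text \<open>Fewer than \<open>d\<close> conjugated vectors, padded with zero rows, form a singular
  square matrix; any nonzero vector in its kernel is orthogonal to all of them.\<close>

lemma exists_orthogonal_vec:
  fixes S :: "complex vec set"
  assumes "finite S" "S \<subseteq> carrier_vec d" "card S < d"
  obtains x where "x \<in> carrier_vec d" "x \<noteq> 0\<^sub>v d" "\<And>u. u \<in> S \<Longrightarrow> x \<bullet>c u = 0"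
proof -
  obtain us where us: "set us = S" "distinct us" using assms(1) finite_distinct_list by blast
  define m where "m = length us"
  have m: "m < d" using us assms(3) distinct_card[of us] by (simp add: m_def)
  define c where "c = (\<lambda>i. if i < m then conjugate (us ! i) else 0\<^sub>v d)"
  have c: "c i \<in> carrier_vec d" for i
    using us assms(2) nth_mem[of i us] by (auto simp: c_def m_def simp del: nth_mem)
  define A where "A = mat\<^sub>r d d (\<lambda>i. if i = m then 0\<^sub>v d else c i)"
  have "det A = 0" unfolding A_def using c by (intro det_row_0[OF m]) auto
  moreover have A: "A \<in> carrier_mat d d" by (simp add: A_def)
  ultimately obtain x where x: "x \<in> carrier_vec d" "x \<noteq> 0\<^sub>v d" "A *\<^sub>v x = 0\<^sub>v d"
    using det_0_iff_vec_prod_zero_field by blast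
  show thesis
  proof (rule that[OF x(1,2)])
    fix u assume "u \<in> S"
    then obtain i where i: "i < m" "us ! i = u" using us by (auto simp: m_def in_set_conv_nth)
    have u: "u \<in> carrier_vec d" using \<open>u \<in> S\<close> assms(2) by auto
    have "(A *\<^sub>v x) $ i = 0" using x i m by simp
    moreover have "(A *\<^sub>v x) $ i = row A i \<bullet> x" using i m A by simp
    moreover have "row A i = c i" using i m c by (simp add: A_def)
    ultimately have "conjugate u \<bullet> x = 0" using i by (simp add: c_def)
    then show "x \<bullet>c u = 0"
      using comm_scalar_prod[of "conjugate u" d x] u x(1) by simp
  qed
qed

lemma orthc_orthc_superset: "G \<subseteq> carrier_vec d \<Longrightarrow> G \<subseteq> orthc d (orthc d G)"
  by (auto simp: orthc_def cscalar_prod_eq_0_swap[of _ d])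

text \<open>One Gram-Schmidt step on \<open>z\<close>. The vector \<open>x\<close> certifies that
  the remainder is not zero: it is orthogonal to \<open>S\<close> but not to \<open>z\<close>. The
  remainder stays in \<open>orthc d H\<close> because every \<open>u\<close> that is really
  subtracted lies there too.\<close>

lemma orthonormal_extend:
  assumes S: "finite S" "orthonormal d S"
    and z: "z \<in> carrier_vec d" and x: "x \<in> carrier_vec d"
    and xS: "\<And>u. u \<in> S \<Longrightarrow> u \<bullet>c x = 0" and zx: "z \<bullet>c x \<noteq> 0"
    and K: "z \<in> orthc d H" "H \<subseteq> carrier_vec d" 
      "\<And>u. u \<in> S \<Longrightarrow> z \<bullet>c u \<noteq> 0 \<Longrightarrow> u \<in> orthc d H"
  obtains v where "v \<in> orthc d H" "v \<notin> S" "orthonormal d (insert v S)"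
proof -
  have Sc: "u \<in> carrier_vec d" if "u \<in> S" for u using S that by (auto simp: orthonormal_def)
  define y where "y = vec d (\<lambda>k. z $ k - (\<Sum>u\<in>S. (z \<bullet>c u) * u $ k))"
  have yc: "y \<in> carrier_vec d" by (simp add: y_def)
  have ip: "y \<bullet>c w = z \<bullet>c w - (\<Sum>u\<in>S. (z \<bullet>c u) * (u \<bullet>c w))" if w: "w \<in> carrier_vec d" for w
  proof -
    have "y \<bullet>c w = (\<Sum>k<d. (z $ k - (\<Sum>u\<in>S. (z \<bullet>c u) * u $ k)) * cnj (w $ k))"
      unfolding cscalar_prod_sum[OF w] by (simp add: y_def)
    also have "\<dots> = (\<Sum>k<d. z $ k * cnj (w $ k)) - (\<Sum>k<d. \<Sum>u\<in>S. (z \<bullet>c u) * (u $ k * cnj (w $ k)))"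
      by (simp add: left_diff_distrib sum_subtractf sum_distrib_right mult.assoc)
    also have "(\<Sum>k<d. \<Sum>u\<in>S. (z \<bullet>c u) * (u $ k * cnj (w $ k))) =
        (\<Sum>u\<in>S. (z \<bullet>c u) * (u \<bullet>c w))"
      by (subst sum.swap) (simp only: cscalar_prod_sum[OF w, where x = u for u] sum_distrib_left)
    finally show ?thesis by (simp only: cscalar_prod_sum[OF w, of z])
  qed
  have "y \<bullet>c x = z \<bullet>c x" using xS by (subst ip[OF x]) simp
  then have "y \<noteq> 0\<^sub>v d" using zx x by auto
  then have nz: "y \<bullet>c y \<noteq> 0" using yc by simp
  have yS: "y \<bullet>c u = 0" if u: "u \<in> S" for u
  proof -
    have "(\<Sum>u'\<in>S. (z \<bullet>c u') * (u' \<bullet>c u)) = (\<Sum>u'\<in>S. if u' = u then z \<bullet>c u else 0)"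
      using S(2) u by (intro sum.cong) (auto simp: orthonormal_def)
    then show ?thesis using S(1) u by (simp add: ip[OF Sc[OF u]])
  qed
  have yH: "h \<bullet>c y = 0" if h: "h \<in> H" for h
  proof -
    have hc: "h \<in> carrier_vec d" using K(2) h by auto
    have "z \<bullet>c h = 0"
      using K(1) h hc z by (auto simp: orthc_def cscalar_prod_eq_0_swap[of z d h])
    moreover have "(z \<bullet>c u) * (u \<bullet>c h) = 0" if "u \<in> S" for u
      using K(3)[OF that] h hc Sc[OF that] by (auto simp: orthc_def cscalar_prod_eq_0_swap[of u d h])
    ultimately have "y \<bullet>c h = 0" by (simp add: ip[OF hc] sum.neutral)
    then show ?thesis using cscalar_prod_eq_0_swap[OF yc hc] by simp
  qed
  define \<rho> where "\<rho> = Re (y \<bullet>c y)"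
  have "y \<bullet>c y \<ge> 0" by (rule conjugate_square_ge_0_vec)
  then have \<rho>: "y \<bullet>c y = complex_of_real \<rho>" "\<rho> > 0"
    using nz by (auto simp: \<rho>_def less_eq_complex_def complex_eq_iff)
  define v where "v = complex_of_real (1 / sqrt \<rho>) \<cdot>\<^sub>v y"
  have vc: "v \<in> carrier_vec d" using yc by (simp add: v_def)
  have vl: "v \<bullet>c w = complex_of_real (1 / sqrt \<rho>) * (y \<bullet>c w)" if "w \<in> carrier_vec d" for w
    using that yc by (simp add: v_def)
  have vS: "v \<bullet>c u = 0" if "u \<in> S" for u using vl[OF Sc[OF that]] yS[OF that] by simp
  have vv: "v \<bullet>c v = 1"
  proof -
    have "v \<bullet>c v = complex_of_real (1 / sqrt \<rho>) * cnj (v \<bullet>c y)"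
      using vl[OF vc] cscalar_prod_swap[OF yc vc] by simp
    also have "\<dots> = complex_of_real (1 / sqrt \<rho> * (1 / sqrt \<rho>) * \<rho>)"
      by (simp only: vl[OF yc] \<rho>(1) complex_cnj_mult complex_cnj_complex_of_real of_real_mult mult.assoc)
    also have "1 / sqrt \<rho> * (1 / sqrt \<rho>) * \<rho> = 1" using \<rho>(2) by (simp add: field_simps)
    finally show ?thesis by simp
  qed
  have "v \<notin> S" using vS vv by auto
  moreover have "h \<bullet>c v = 0" if "h \<in> H" for h
  proof -
    have hc: "h \<in> carrier_vec d" using K(2) that by auto
    have "v \<bullet>c h = 0" using vl[OF hc] yH[OF that] cscalar_prod_eq_0_swap[OF yc hc] by simp
    then show ?thesis using cscalar_prod_eq_0_swap[OF vc hc] by simp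
  qed
  then have "v \<in> orthc d H" using vc by (auto simp: orthc_def)
  moreover have "orthonormal d (insert v S)"
    unfolding orthonormal_def
  proof (intro conjI ballI)
    show "insert v S \<subseteq> carrier_vec d" using vc Sc by auto
    fix a b assume "a \<in> insert v S" "b \<in> insert v S"
    moreover have "a \<bullet>c v = 0" if "a \<in> S"
      using vS[OF that] cscalar_prod_eq_0_swap[OF vc Sc[OF that]] by simp
    ultimately show "a \<bullet>c b = (if a = b then 1 else 0)"
      using vv vS S(2) \<open>v \<notin> S\<close> by (auto simp: orthonormal_def)
  qed
  ultimately show thesis using that by blast
qed

text \<open>Greedy choice: as long as fewer than \<open>d\<close> vectors are chosen, some nonzero
  \<open>x\<close> is orthogonal to them, and \<open>total\<close> provides a \<open>z\<close> in
  some \<open>G i\<close> that sees \<open>x\<close>. Gram-Schmidt on \<open>z\<close> stays in the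
  span of \<open>G i\<close>, since chosen vectors from other spans are orthogonal to
  \<open>z\<close>.\<close>

lemma adapted_orthonormal_basis:
  fixes G :: "nat \<Rightarrow> complex vec set"
  assumes G: "\<And>i. i < g \<Longrightarrow> G i \<subseteq> carrier_vec d"
    and orth: "\<And>i j x y. i < g \<Longrightarrow> j < g \<Longrightarrow> i \<noteq> j \<Longrightarrow> x \<in> G i \<Longrightarrow> y \<in> G j \<Longrightarrow> x \<bullet>c y = 0"
    and total: "\<And>x. x \<in> carrier_vec d \<Longrightarrow> (\<And>i z. i < g \<Longrightarrow> z \<in> G i \<Longrightarrow> z \<bullet>c x = 0) \<Longrightarrow> x = 0\<^sub>v d"
  obtains L where "distinct (concat (map L [0..<g]))" "length (concat (map L [0..<g])) = d"
    "orthonormal d (set (concat (map L [0..<g])))"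
    "\<And>i j z u. i < g \<Longrightarrow> j < g \<Longrightarrow> i \<noteq> j \<Longrightarrow> z \<in> G j \<Longrightarrow> u \<in> set (L i) \<Longrightarrow> z \<bullet>c u = 0"
    "\<And>i j u v. i < g \<Longrightarrow> j < g \<Longrightarrow> i \<noteq> j \<Longrightarrow> u \<in> set (L i) \<Longrightarrow> v \<in> set (L j) \<Longrightarrow> u \<bullet>c v = 0"
proof -
  \<comment> \<open>The spans of the \<open>G i\<close>; orthogonality passes to them from the
    generators, first in one argument and then in the other.\<close>
  define K where "K i = orthc d (orthc d (G i))" for i
  have GK: "G i \<subseteq> K i" if "i < g" for i
    unfolding K_def by (rule orthc_orthc_superset[OF G[OF that]])
  have Kc: "K i \<subseteq> carrier_vec d" for i by (auto simp: K_def orthc_def)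
  have KG: "z \<bullet>c y = 0" if "i < g" "j < g" "i \<noteq> j" "z \<in> G i" "y \<in> K j" for i j z y
  proof -
    have "z \<in> orthc d (G j)" using orth that G[OF that(1)] by (auto simp: orthc_def)
    then show ?thesis using that(5) by (auto simp: K_def orthc_def)
  qed
  have KK: "x \<bullet>c y = 0" if "i < g" "j < g" "i \<noteq> j" "x \<in> K i" "y \<in> K j" for i j x y
  proof -
    have "y \<in> orthc d (G i)" using KG[OF that(1-3) _ that(5)] that(5) Kc by (auto simp: orthc_def)
    then have "y \<bullet>c x = 0" using that(4) by (auto simp: K_def orthc_def)
    then show ?thesis using that Kc cscalar_prod_eq_0_swap[of x d y] by auto
  qed
  have "\<exists>S. finite S \<and> card S = m \<and> orthonormal d S \<and> S \<subseteq> (\<Union>i<g. K i)" if "m \<le> d" for m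
    using that
  proof (induction m)
    case 0
    then show ?case by (intro exI[of _ "{}"]) (simp add: orthonormal_def)
  next
    case (Suc m)
    then obtain S where S: "finite S" "card S = m" "orthonormal d S" "S \<subseteq> (\<Union>i<g. K i)" by auto
    then have Sc: "S \<subseteq> carrier_vec d" by (auto simp: orthonormal_def)
    obtain x where x: "x \<in> carrier_vec d" "x \<noteq> 0\<^sub>v d" "\<And>u. u \<in> S \<Longrightarrow> x \<bullet>c u = 0"
      using exists_orthogonal_vec[OF S(1) Sc] S(2) Suc.prems by auto
    obtain i z where i: "i < g" "z \<in> G i" "z \<bullet>c x \<noteq> 0" using total[OF x(1)] x(2) by blast
    have zK: "z \<in> K i" using GK i by auto
    obtain v where v: "v \<in> K i" "v \<notin> S" "orthonormal d (insert v S)"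
    proof (rule orthonormal_extend[OF S(1,3) _ x(1) _ i(3), of "orthc d (G i)"])
      show "z \<in> carrier_vec d" using zK Kc by auto
      show "u \<bullet>c x = 0" if "u \<in> S" for u
        using x(3)[OF that] that Sc x(1) cscalar_prod_eq_0_swap[of u d x] by auto
      show "z \<in> orthc d (orthc d (G i))" using zK by (simp add: K_def)
      show "orthc d (G i) \<subseteq> carrier_vec d" by (auto simp: orthc_def)
      show "u \<in> orthc d (orthc d (G i))" if u: "u \<in> S" "z \<bullet>c u \<noteq> 0" for u
      proof -
        obtain j where j: "j < g" "u \<in> K j" using u S(4) by auto
        then have "j = i" using KK[OF i(1) j(1) _ zK j(2)] u by auto
        then show ?thesis using j by (simp add: K_def)
      qed
    qed (auto simp: K_def)
    show ?case using S v i by (intro exI[of _ "insert v S"]) auto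
  qed
  then obtain S where S: "finite S" "card S = d" "orthonormal d S" "S \<subseteq> (\<Union>i<g. K i)" by blast
  \<comment> \<open>A span that is zero contributes the empty list, hence a block of size 0.\<close>
  have "\<exists>L. set L = S \<inter> K i \<and> distinct L" for i
    by (rule finite_distinct_list) (use S(1) in auto)
  then obtain L where L: "\<And>i. set (L i) = S \<inter> K i" "\<And>i. distinct (L i)" by metis
  have set: "set (concat (map L [0..<g])) = S" using S(4) L by (auto simp: atLeast0LessThan)
  have "S = (\<Union>i<g. set (L i))" using S(4) L by auto
  then have "card S = card (\<Union>i<g. set (L i))" by simp
  also have "\<dots> = (\<Sum>i<g. card (set (L i)))"
  proof (rule card_UN_disjoint)
    show "\<forall>i\<in>{..<g}. \<forall>j\<in>{..<g}. i \<noteq> j \<longrightarrow> set (L i) \<inter> set (L j) = {}"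
    proof (intro ballI impI equals0I)
      fix i j u assume "i \<in> {..<g}" "j \<in> {..<g}" "i \<noteq> j" "u \<in> set (L i) \<inter> set (L j)"
      then have "u \<bullet>c u = 0" "u \<in> S" using KK[of i j u u] L by auto
      then show False using S(3) by (auto simp: orthonormal_def)
    qed
  qed auto
  also have "\<dots> = length (concat (map L [0..<g]))"
    by (simp add: distinct_card L(2) length_concat comp_def sum_list_distinct_conv_sum_set atLeast0LessThan)
  finally have len: "length (concat (map L [0..<g])) = card S" by simp
  show thesis
  proof (rule that)
    \<comment> \<open>The length of the concatenation equals the number of its elements, because a
      vector common to two lists would be orthogonal to itself.\<close>
    show "distinct (concat (map L [0..<g]))" by (rule card_distinct) (simp only: set len)
    show "length (concat (map L [0..<g])) = d" using len S(2) by simp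
    show "orthonormal d (set (concat (map L [0..<g])))" unfolding set by (rule S(3))
    show "z \<bullet>c u = 0" if "i < g" "j < g" "i \<noteq> j" "z \<in> G j" "u \<in> set (L i)" for i j z u
      using KG[of j i z u] that L(1) by auto
    show "u \<bullet>c v = 0" if "i < g" "j < g" "i \<noteq> j" "u \<in> set (L i)" "v \<in> set (L j)" for i j u v
      using KK[of i j u v] that L(1) by auto
  qed
qed

text \<open>With the vectors \<open>us\<close> as the columns of \<open>V\<close> this is
  \<open>V^* B V\<close>; for an orthonormal list it is the matrix of the compression of
  \<open>B\<close> to their span. Entries given by inner products make it easy to cut the list into
  blocks.\<close>

definition gram :: "complex vec list \<Rightarrow> complex mat \<Rightarrow> complex mat" where
  "gram us B = mat (length us) (length us) (\<lambda>(r, s). (B *\<^sub>v us ! s) \<bullet>c (us ! r))"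

lemma gram_carrier [simp]: "gram us B \<in> carrier_mat (length us) (length us)"
  by (simp add: gram_def)

lemma dim_gram [simp]: "dim_row (gram us B) = length us" "dim_col (gram us B) = length us"
  by (simp_all add: gram_def)

lemma gram_conv_mult:
  assumes "set us \<subseteq> carrier_vec d" "B \<in> carrier_mat d d"
  shows "mat_adjoint (mat_of_cols d us) * B * mat_of_cols d us = gram us B"
proof (rule eq_matI)
  let ?V = "mat_of_cols d us" and ?n = "length us"
  have c: "?V \<in> carrier_mat d ?n" by simp
  fix r s assume "r < dim_row (gram us B)" "s < dim_col (gram us B)"
  then have rs: "r < ?n" "s < ?n" by auto
  then have us: "us ! r \<in> carrier_vec d" "us ! s \<in> carrier_vec d" using assms nth_mem by blast+
  have "(mat_adjoint ?V * B * ?V) $$ (r, s) = (mat_adjoint ?V * (B * ?V)) $$ (r, s)"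
    by (subst assoc_mult_mat[of _ ?n d _ d _ ?n]) (use c assms in auto)
  also have "\<dots> = (\<Sum>k<d. mat_adjoint ?V $$ (r, k) * (B * ?V) $$ (k, s))"
    by (rule index_mult_mat_sum[of _ ?n d _ ?n]) (use c assms rs in auto)
  also have "\<dots> = (\<Sum>k<d. (B *\<^sub>v us ! s) $ k * cnj (us ! r $ k))"
  proof (rule sum.cong[OF refl])
    fix k assume "k \<in> {..<d}"
    then show "mat_adjoint ?V $$ (r, k) * (B * ?V) $$ (k, s) = (B *\<^sub>v us ! s) $ k * cnj (us ! r $ k)"
      using rs us assms by (simp add: mat_of_cols_index col_mat_of_cols)
  qed
  also have "\<dots> = gram us B $$ (r, s)"
    using rs us by (simp add: gram_def cscalar_prod_sum)
  finally show "(mat_adjoint ?V * B * ?V) $$ (r, s) = gram us B $$ (r, s)" .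
qed auto

lemma gram_orthonormal:
  assumes "distinct us" "orthonormal d (set us)"
  shows "gram us (1\<^sub>m d) = 1\<^sub>m (length us)"
proof (rule eq_matI)
  fix r s assume "r < dim_row (1\<^sub>m (length us))" "s < dim_col (1\<^sub>m (length us))"
  then have rs: "r < length us" "s < length us" by auto
  then have "us ! r \<in> set us" "us ! s \<in> set us" by auto
  then show "gram us (1\<^sub>m d) $$ (r, s) = 1\<^sub>m (length us) $$ (r, s)"
    using assms rs by (auto simp: gram_def orthonormal_def nth_eq_iff_index_eq subset_iff)
qed auto

lemma unitary_mat_of_cols:
  assumes "distinct us" "orthonormal d (set us)" "length us = d"
  shows "unitary_mat d (mat_of_cols d us)"
proof -
  let ?V = "mat_of_cols d us"
  have V: "?V \<in> carrier_mat d d" using assms(3) by auto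
  have "mat_adjoint ?V * 1\<^sub>m d * ?V = 1\<^sub>m d"
    using gram_conv_mult[of us d "1\<^sub>m d"] gram_orthonormal[OF assms(1,2)] assms
    by (simp add: orthonormal_def)
  moreover have "mat_adjoint ?V * 1\<^sub>m d = mat_adjoint ?V" using V by (intro right_mult_one_mat) simp
  ultimately have "mat_adjoint ?V * ?V = 1\<^sub>m d" by simp
  then show ?thesis
    unfolding unitary_mat_def using V mat_mult_left_right_inverse[of "mat_adjoint ?V" d ?V] by simp
qed

text \<open>Splitting off one list at a time leaves two off-diagonal corners. Both vanish because
  the hypothesis applies to the pair of indices in either order.\<close>

lemma gram_concat:
  assumes "distinct js"
    and "\<And>i j x y. i \<in> set js \<Longrightarrow> j \<in> set js \<Longrightarrow> i \<noteq> j \<Longrightarrow> x \<in> set (L i) \<Longrightarrow> y \<in> set (L j) \<Longrightarrow>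
      (B *\<^sub>v y) \<bullet>c x = 0"
  shows "gram (concat (map L js)) B = diag_block_mat (map (\<lambda>i. gram (L i) B) js)"
  using assms
proof (induction js)
  case Nil
  show ?case by (rule eq_matI) auto
next
  case (Cons i js)
  let ?R = "concat (map L js)"
  have IH: "diag_block_mat (map (\<lambda>i. gram (L i) B) js) = gram ?R B"
    by (rule Cons.IH[symmetric]) (use Cons.prems in auto)
  have off: "(B *\<^sub>v y) \<bullet>c x = 0" "(B *\<^sub>v x) \<bullet>c y = 0" if xy: "x \<in> set (L i)" "y \<in> set ?R" for x y
  proof -
    obtain j where j: "j \<in> set js" "y \<in> set (L j)" using xy by auto
    then have "j \<noteq> i" using Cons.prems(1) by auto
    then show "(B *\<^sub>v y) \<bullet>c x = 0" "(B *\<^sub>v x) \<bullet>c y = 0"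
      using Cons.prems(2)[of i j x y] Cons.prems(2)[of j i y x] j xy by auto
  qed
  show ?case
    unfolding list.map diag_block_mat.simps IH Let_def
  proof (rule eq_matI, goal_cases)
    case (1 r s)
    then have "r < length (L i) + length ?R" "s < length (L i) + length ?R" by auto
    moreover have "?R ! (r - length (L i)) \<in> set ?R" if "\<not> r < length (L i)"
      using that calculation by (intro nth_mem) auto
    moreover have "?R ! (s - length (L i)) \<in> set ?R" if "\<not> s < length (L i)"
      using that calculation by (intro nth_mem) auto
    ultimately show ?case
      by (auto simp: gram_def nth_append off)
  qed auto
qed

section \<open>Evaluation and restriction to words of fixed weight\<close>

lemma letter_eval_carrier:
  "X (letter_index l) \<in> carrier_mat n n \<Longrightarrow> letter_eval X l \<in> carrier_mat n n"
  by (cases l) auto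

lemma word_eval_carrier:
  assumes "\<And>l. l \<in> set w \<Longrightarrow> X (letter_index l) \<in> carrier_mat n n"
  shows "word_eval n X w \<in> carrier_mat n n"
  using assms by (induction w) (auto intro!: mult_carrier_mat[of _ n n] letter_eval_carrier)

text \<open>Summing over any finite superset of the support allows a chosen word to be included even
  when its coefficient might be zero.\<close>

lemma index_poly_eval:
  assumes "finite S" "poly_support d p \<subseteq> S" "x < d * n" "y < d * n"
    and "\<And>w. w \<in> S \<Longrightarrow> word_eval n X w \<in> carrier_mat n n"
  shows "poly_eval d n p X $$ (x, y) = (\<Sum>w\<in>S. kron (p w) (word_eval n X w) $$ (x, y))"
proof -
  have "kron (p w) (word_eval n X w) $$ (x, y) = 0" if w: "w \<in> S - poly_support d p" for w
  proof -
    obtain a r where x: "a < d" "r < n" "x = a * n + r" using block_indexE[OF assms(3)] .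
    obtain b s where y: "b < d" "s < n" "y = b * n + s" using block_indexE[OF assms(4)] .
    have "p w = 0\<^sub>m d d" using w by (simp add: poly_support_def)
    then show ?thesis
      using index_kron[of "0\<^sub>m d d" d d "word_eval n X w" n n a r b s] assms(5)[of w] w x y by simp
  qed
  then show ?thesis
    unfolding poly_eval_def using assms by (auto intro!: sum.mono_neutral_left)
qed

lemma index_poly_eval_block:
  assumes "finite S" "poly_support d p \<subseteq> S" "\<And>w. p w \<in> carrier_mat d d"
    and "\<And>w. w \<in> S \<Longrightarrow> word_eval n X w \<in> carrier_mat n n"
    and "a < d" "r < n" "b < d" "s < n"
  shows "poly_eval d n p X $$ (a * n + r, b * n + s) = (\<Sum>w\<in>S. p w $$ (a, b) * word_eval n X w $$ (r, s))"
proof -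
  have "poly_eval d n p X $$ (a * n + r, b * n + s) =
      (\<Sum>w\<in>S. kron (p w) (word_eval n X w) $$ (a * n + r, b * n + s))"
    by (rule index_poly_eval) (use assms in \<open>auto simp: block_index_less\<close>)
  also have "\<dots> = (\<Sum>w\<in>S. p w $$ (a, b) * word_eval n X w $$ (r, s))"
    by (rule sum.cong[OF refl], rule index_kron[of _ d d]) (use assms in auto)
  finally show ?thesis .
qed

lemma poly_eval_carrier [simp]: "poly_eval d n p X \<in> carrier_mat (d * n) (d * n)"
  by (simp add: poly_eval_def)

text \<open>Linearity of \<open>A * _ * B\<close>, phrased for entries because
  \<open>poly_eval\<close> is itself an entrywise sum.\<close>

lemma index_mult_sum_mult:
  fixes A C B :: "complex mat"
  assumes "A \<in> carrier_mat N N" "B \<in> carrier_mat N N" "C \<in> carrier_mat N N"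
    and "\<And>w. w \<in> S \<Longrightarrow> K w \<in> carrier_mat N N"
    and C: "\<And>i j. i < N \<Longrightarrow> j < N \<Longrightarrow> C $$ (i, j) = (\<Sum>w\<in>S. K w $$ (i, j))"
    and xy: "x < N" "y < N"
  shows "(A * C * B) $$ (x, y) = (\<Sum>w\<in>S. (A * K w * B) $$ (x, y))"
proof -
  have expand: "(A * M * B) $$ (x, y) = (\<Sum>j<N. (\<Sum>i<N. A $$ (x, i) * M $$ (i, j)) * B $$ (j, y))"
    if M: "M \<in> carrier_mat N N" for M
  proof -
    have "(A * M * B) $$ (x, y) = (\<Sum>j<N. (A * M) $$ (x, j) * B $$ (j, y))"
      by (rule index_mult_mat_sum[OF mult_carrier_mat[OF assms(1) M] assms(2) xy])
    also have "\<dots> = (\<Sum>j<N. (\<Sum>i<N. A $$ (x, i) * M $$ (i, j)) * B $$ (j, y))"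
      by (intro sum.cong refl arg_cong2[of _ _ _ _ "(*)"] index_mult_mat_sum[OF assms(1) M xy(1)]) simp
    finally show ?thesis .
  qed
  have "(A * C * B) $$ (x, y) = (\<Sum>j<N. \<Sum>i<N. \<Sum>w\<in>S. A $$ (x, i) * K w $$ (i, j) * B $$ (j, y))"
    by (simp add: expand[OF assms(3)] C sum_distrib_left sum_distrib_right del: index_mult_mat)
  also have "\<dots> = (\<Sum>j<N. \<Sum>w\<in>S. \<Sum>i<N. A $$ (x, i) * K w $$ (i, j) * B $$ (j, y))"
    by (intro sum.cong refl sum.swap)
  also have "\<dots> = (\<Sum>w\<in>S. \<Sum>j<N. \<Sum>i<N. A $$ (x, i) * K w $$ (i, j) * B $$ (j, y))"
    by (rule sum.swap)
  also have "\<dots> = (\<Sum>w\<in>S. (A * K w * B) $$ (x, y))"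
    by (intro sum.cong refl) (simp add: expand[OF assms(4)] sum_distrib_right del: index_mult_mat)
  finally show ?thesis .
qed

definition restrict_poly :: "nat \<Rightarrow> (letter list \<Rightarrow> bool) \<Rightarrow> free_poly \<Rightarrow> free_poly" where
  "restrict_poly d P p = (\<lambda>w. if P w then p w else 0\<^sub>m d d)"

text \<open>A variable and its adjoint have the same weight. Two gradings matter below: constant
  weight 1 measures the length, and the indicator of \<open>i\<close> counts the letters with index
  \<open>i\<close>.\<close>

definition weight :: "(nat \<Rightarrow> nat) \<Rightarrow> letter list \<Rightarrow> nat" where
  "weight c w = (\<Sum>l\<leftarrow>w. c (letter_index l))"

text \<open>The restriction to tuples with all entries (not only the first \<open>g\<close>) of the right size
  costs nothing, since only the first \<open>g\<close> entries matter.\<close>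

definition intertwines :: "nat \<Rightarrow> nat \<Rightarrow> free_poly \<Rightarrow> (nat \<Rightarrow> complex mat) \<Rightarrow> complex mat \<Rightarrow> bool" where
  "intertwines d n p U W \<longleftrightarrow> (\<forall>X. (\<forall>i. X i \<in> carrier_mat n n) \<longrightarrow>
     poly_eval d n p (\<lambda>i. mat_adjoint (U i) * X i * U i) = mat_adjoint W * poly_eval d n p X * W)"

text \<open>Grouping the words by \<open>f w\<close> gives a polynomial in \<open>t\<close>. All
  real numbers are roots, so every coefficient of it is zero.\<close>

lemma weighted_sum_eq_0:
  fixes F :: "'a \<Rightarrow> complex"
  assumes "finite S" and zero: "\<And>t :: real. (\<Sum>w\<in>S. complex_of_real t ^ f w * F w) = 0"
  shows "(\<Sum>w\<in>{w \<in> S. f w = m}. F w) = 0"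
proof -
  obtain N where N: "\<And>w. w \<in> S \<Longrightarrow> f w \<le> N" "m \<le> N"
    using finite_nat_set_iff_bounded_le[of "insert m (f ` S)"] assms(1) by auto
  define c where "c i = (\<Sum>w\<in>{w \<in> S. f w = i}. F w)" for i
  have poly: "(\<Sum>i\<le>N. c i * z ^ i) = (\<Sum>w\<in>S. z ^ f w * F w)" for z
  proof -
    have "(\<Sum>w\<in>S. z ^ f w * F w) = (\<Sum>i\<le>N. \<Sum>w\<in>{w \<in> S. f w = i}. z ^ f w * F w)"
      using N assms(1) by (intro sum.group[symmetric]) auto
    also have "\<dots> = (\<Sum>i\<le>N. c i * z ^ i)"
      by (intro sum.cong refl) (simp add: c_def sum_distrib_left mult.commute)
    finally show ?thesis by simp
  qed
  have "range complex_of_real \<subseteq> {z. (\<Sum>i\<le>N. c i * z ^ i) = 0}"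
    by (auto simp: poly zero)
  moreover have "infinite (range complex_of_real)"
    using infinite_UNIV_char_0[where 'a = real] by (simp add: finite_image_iff inj_of_real)
  ultimately have "infinite {z. (\<Sum>i\<le>N. c i * z ^ i) = 0}" using finite_subset by blast
  then have "c m = 0" using polyfun_finite_roots[of c N] N(2) by blast
  then show ?thesis by (simp add: c_def)
qed

text \<open>The parameter \<open>t\<close> has to be real: then \<open>x_i\<close> and its adjoint
  are multiplied by the same power, whereas a complex factor would be conjugated in the
  adjoint.\<close>

lemma word_eval_scale:
  fixes X :: "nat \<Rightarrow> complex mat" and t :: real
  assumes "\<And>i. X i \<in> carrier_mat n n"
  shows "word_eval n (\<lambda>i. complex_of_real t ^ c i \<cdot>\<^sub>m X i) w = complex_of_real t ^ weight c w \<cdot>\<^sub>m word_eval n X w"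
proof (induction w)
  case Nil
  show ?case by (rule eq_matI) (auto simp: weight_def)
next
  case (Cons l w)
  have w: "word_eval n X w \<in> carrier_mat n n" and l: "letter_eval X l \<in> carrier_mat n n"
    using assms by (auto intro: word_eval_carrier letter_eval_carrier)
  have scale: "letter_eval (\<lambda>i. complex_of_real t ^ c i \<cdot>\<^sub>m X i) l =
      complex_of_real t ^ c (letter_index l) \<cdot>\<^sub>m letter_eval X l"
    by (cases l; simp; rule eq_matI) (use assms in auto)
  show ?case
    unfolding word_eval.simps Cons scale using l w
    by (simp add: mult_smult_distrib[of _ n n _ n] mult_smult_assoc_mat[of _ n n _ n]
        weight_def power_add) (rule eq_matI; simp)
qed

lemma smult_kron_conj:
  assumes "A \<in> carrier_mat (d * n) (d * n)" "B \<in> carrier_mat (d * n) (d * n)"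
    "P \<in> carrier_mat d d" "M \<in> carrier_mat n n"
  shows "A * kron P (c \<cdot>\<^sub>m M) * B = c \<cdot>\<^sub>m (A * kron P M * B)" "kron P (c \<cdot>\<^sub>m M) = c \<cdot>\<^sub>m kron P M"
proof -
  have k: "kron P M \<in> carrier_mat (d * n) (d * n)" "kron P (c \<cdot>\<^sub>m M) \<in> carrier_mat (d * n) (d * n)"
    using assms by (simp_all add: kron_carrier)
  show eq: "kron P (c \<cdot>\<^sub>m M) = c \<cdot>\<^sub>m kron P M"
  proof (rule block_mat_eqI[OF k(2)])
    show "c \<cdot>\<^sub>m kron P M \<in> carrier_mat (d * n) (d * n)" using k by simp
    fix a r b s assume i: "a < d" "r < n" "b < d" "s < n"
    then have "(c \<cdot>\<^sub>m kron P M) $$ (a * n + r, b * n + s) = c * kron P M $$ (a * n + r, b * n + s)"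
      using k by (intro index_smult_mat) (auto simp: block_index_less)
    then show "kron P (c \<cdot>\<^sub>m M) $$ (a * n + r, b * n + s) = (c \<cdot>\<^sub>m kron P M) $$ (a * n + r, b * n + s)"
      using i index_kron[OF assms(3) smult_carrier_mat[OF assms(4)] i] index_kron[OF assms(3,4) i] assms(4)
      by simp
  qed
  show "A * kron P (c \<cdot>\<^sub>m M) * B = c \<cdot>\<^sub>m (A * kron P M * B)"
    unfolding eq using assms(1,2) k(1)
    by (simp add: mult_smult_distrib[of _ "d * n" "d * n" _ "d * n"]
        mult_smult_assoc_mat[of _ "d * n" "d * n" _ "d * n"])
qed

lemma restrict_poly_carrier: "(\<And>w. p w \<in> carrier_mat d d) \<Longrightarrow> restrict_poly d P p w \<in> carrier_mat d d"
  by (simp add: restrict_poly_def)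

lemma poly_support_restrict: "poly_support d (restrict_poly d P p) = {w \<in> poly_support d p. P w}"
  by (auto simp: poly_support_def restrict_poly_def)

text \<open>Replacing \<open>x\<^sub>i\<close> by \<open>t ^ c i * x\<^sub>i\<close> multiplies the part of weight \<open>m\<close> by \<open>t ^ m\<close>. As \<open>W\<close> does not
  depend on \<open>X\<close>, comparing coefficients of \<open>t\<close> shows that \<open>W\<close> works for each part separately.\<close>

lemma intertwines_restrict:
  assumes p: "\<And>w. p w \<in> carrier_mat d d" "finite (poly_support d p)"
    and U: "\<And>i. U i \<in> carrier_mat n n" and W: "W \<in> carrier_mat (d * n) (d * n)"
    and rel: "intertwines d n p U W"
  shows "intertwines d n (restrict_poly d (\<lambda>w. weight c w = m) p) U W"
  unfolding intertwines_def
proof (intro allI impI)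
  fix X :: "nat \<Rightarrow> complex mat" assume "\<forall>i. X i \<in> carrier_mat n n"
  then have X: "X i \<in> carrier_mat n n" for i by blast
  let ?q = "restrict_poly d (\<lambda>w. weight c w = m) p" and ?S = "poly_support d p" and ?N = "d * n"
  let ?Y = "\<lambda>i. mat_adjoint (U i) * X i * U i"
  have Y: "?Y i \<in> carrier_mat n n" for i
    using X U by (intro mult_carrier_mat[of _ n n]) simp_all
  have Wa: "mat_adjoint W \<in> carrier_mat ?N ?N" using W by simp
  have we: "word_eval n Z w \<in> carrier_mat n n" if "\<And>i. Z i \<in> carrier_mat n n" for Z w
    using that by (intro word_eval_carrier)
  have ke: "kron (p w) (word_eval n Z w) \<in> carrier_mat ?N ?N" if "\<And>i. Z i \<in> carrier_mat n n" for Z w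
    using we[OF that] p(1) by (intro kron_carrier)
  show "poly_eval d n ?q ?Y = mat_adjoint W * poly_eval d n ?q X * W"
  proof (rule eq_matI)
    fix x y assume "x < dim_row (mat_adjoint W * poly_eval d n ?q X * W)"
      "y < dim_col (mat_adjoint W * poly_eval d n ?q X * W)"
    then have xy: "x < ?N" "y < ?N" using W by auto
    \<comment> \<open>The defect of the intertwining relation for a single word at one entry. The
      relation at the scaled tuple says that the sum of the defects, weighted by powers of
      \<open>t\<close>, is zero.\<close>
    define F where "F w = (mat_adjoint W * kron (p w) (word_eval n X w) * W) $$ (x, y) -
      kron (p w) (word_eval n ?Y w) $$ (x, y)" for w
    have "(\<Sum>w\<in>?S. complex_of_real t ^ weight c w * F w) = 0" for t
    proof -
      let ?sc = "\<lambda>i. complex_of_real t ^ c i"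
      let ?Xt = "\<lambda>i. ?sc i \<cdot>\<^sub>m X i" and ?Yt = "\<lambda>i. ?sc i \<cdot>\<^sub>m ?Y i"
      have Xt: "?Xt i \<in> carrier_mat n n" and Yt: "?Yt i \<in> carrier_mat n n" for i
        using X Y by (auto intro: smult_carrier_mat)
      have "?Yt = (\<lambda>i. mat_adjoint (U i) * ?Xt i * U i)"
      proof
        fix i
        have "mat_adjoint (U i) * ?Xt i = ?sc i \<cdot>\<^sub>m (mat_adjoint (U i) * X i)"
          by (rule mult_smult_distrib[of _ n n _ n]) (use X U in auto)
        also have "\<dots> * U i = ?Yt i"
          by (rule mult_smult_assoc_mat[of _ n n _ n]) (use X U in \<open>auto intro!: mult_carrier_mat[of _ n n]\<close>)
        finally show "?Yt i = mat_adjoint (U i) * ?Xt i * U i" by simp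
      qed
      then have "poly_eval d n p ?Yt = mat_adjoint W * poly_eval d n p ?Xt * W"
        using rel Xt by (simp add: intertwines_def)
      then have "poly_eval d n p ?Yt $$ (x, y) = (mat_adjoint W * poly_eval d n p ?Xt * W) $$ (x, y)"
        by simp
      moreover have "poly_eval d n p ?Yt $$ (x, y) = (\<Sum>w\<in>?S. kron (p w) (word_eval n ?Yt w) $$ (x, y))"
        using p(2) xy we[OF Yt] by (intro index_poly_eval) auto
      moreover have "(mat_adjoint W * poly_eval d n p ?Xt * W) $$ (x, y) =
          (\<Sum>w\<in>?S. (mat_adjoint W * kron (p w) (word_eval n ?Xt w) * W) $$ (x, y))"
        by (rule index_mult_sum_mult[OF Wa W poly_eval_carrier ke[OF Xt] index_poly_eval xy])
          (use p(2) we[OF Xt] in auto)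
      ultimately have "0 = (\<Sum>w\<in>?S. (mat_adjoint W * kron (p w) (word_eval n ?Xt w) * W) $$ (x, y) -
          kron (p w) (word_eval n ?Yt w) $$ (x, y))" by (simp add: sum_subtractf del: index_mult_mat)
      also have "\<dots> = (\<Sum>w\<in>?S. complex_of_real t ^ weight c w * F w)"
      proof (rule sum.cong[OF refl])
        fix w
        have M: "mat_adjoint W * kron (p w) (word_eval n X w) * W \<in> carrier_mat ?N ?N"
          using Wa W ke[OF X] by (intro mult_carrier_mat)
        show "(mat_adjoint W * kron (p w) (word_eval n ?Xt w) * W) $$ (x, y) -
          kron (p w) (word_eval n ?Yt w) $$ (x, y) = complex_of_real t ^ weight c w * F w"
          unfolding word_eval_scale[OF X] word_eval_scale[OF Y]
            smult_kron_conj(1)[OF Wa W p(1) we[OF X]] smult_kron_conj(2)[OF Wa W p(1) we[OF Y]]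
          using xy carrier_matD[OF M] carrier_matD[OF ke[OF Y, of w]]
          by (simp add: F_def right_diff_distrib del: index_mult_mat)
      qed
      finally show ?thesis by simp
    qed
    from weighted_sum_eq_0[OF p(2) this] have F0: "(\<Sum>w\<in>{w \<in> ?S. weight c w = m}. F w) = 0" .
    let ?T = "{w \<in> ?S. weight c w = m}"
    have T: "finite ?T" "poly_support d ?q \<subseteq> ?T" using p(2) by (auto simp: poly_support_restrict)
    have q: "?q w = p w" if "w \<in> ?T" for w using that by (simp add: restrict_poly_def)
    have sum: "poly_eval d n ?q Z $$ (i, j) = (\<Sum>w\<in>?T. kron (p w) (word_eval n Z w) $$ (i, j))"
      if "\<And>i. Z i \<in> carrier_mat n n" "i < ?N" "j < ?N" for Z i j
      using index_poly_eval[OF T that(2,3) we[OF that(1)]] q by simp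
    have "(mat_adjoint W * poly_eval d n ?q X * W) $$ (x, y) =
        (\<Sum>w\<in>?T. (mat_adjoint W * kron (p w) (word_eval n X w) * W) $$ (x, y))"
      by (rule index_mult_sum_mult[OF Wa W poly_eval_carrier ke[OF X] sum[OF X] xy])
    then show "poly_eval d n ?q ?Y $$ (x, y) = (mat_adjoint W * poly_eval d n ?q X * W) $$ (x, y)"
      using F0 sum[OF Y xy] by (simp add: F_def sum_subtractf del: index_mult_mat)
  qed (use W in \<open>auto simp: poly_eval_def\<close>)
qed

section \<open>Extracting coefficients with paths\<close>

fun letter_bar :: "letter \<Rightarrow> letter" where
  "letter_bar (Var i) = Adj i"
| "letter_bar (Adj i) = Var i"

text \<open>The graph with vertices \<open>a 0, \<dots>, a k\<close> whose \<open>t\<close>-th edge carries the \<open>t\<close>-th letter of \<open>v\<close>: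
  among the words of length at most \<open>k\<close> only \<open>v\<close> itself leads from \<open>a 0\<close> to \<open>a k\<close>.\<close>

definition path_tuple :: "nat \<Rightarrow> (nat \<Rightarrow> nat) \<Rightarrow> letter list \<Rightarrow> nat \<Rightarrow> complex mat" where
  "path_tuple n a v j = mat n n (\<lambda>(r, s).
     if \<exists>t<length v. v ! t = Var j \<and> r = a t \<and> s = a (Suc t) \<or> v ! t = Adj j \<and> r = a (Suc t) \<and> s = a t
     then 1 else 0)"

lemma path_tuple_carrier [simp]: "path_tuple n a v j \<in> carrier_mat n n"
  by (simp add: path_tuple_def)

text \<open>An edge labelled \<open>l\<close> is walked forwards by \<open>l\<close> and backwards
  by the adjoint letter. As the entries are 0 or 1, conjugation does not affect them, so variables
  and adjoints obey one formula.\<close>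

lemma index_letter_eval_path:
  assumes "r < n" "s < n"
  shows "letter_eval (path_tuple n a v) l $$ (r, s) =
    (if \<exists>t<length v. v ! t = l \<and> r = a t \<and> s = a (Suc t) \<or> v ! t = letter_bar l \<and> r = a (Suc t) \<and> s = a t
     then 1 else 0)"
proof (cases l)
  case (Var j)
  then show ?thesis using assms by (simp add: path_tuple_def)
next
  case (Adj j)
  have "letter_eval (path_tuple n a v) l $$ (r, s) = cnj (path_tuple n a v j $$ (s, r))"
    using assms carrier_matD[OF path_tuple_carrier[of n a v j]] by (simp add: Adj)
  then show ?thesis using assms by (auto simp: path_tuple_def Adj)
qed

lemma word_eval_path_carrier [simp]: "word_eval n (path_tuple n a v) u \<in> carrier_mat n n"
  by (rule word_eval_carrier) simp

lemma word_eval_Cons_index: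
  assumes "\<And>i. X i \<in> carrier_mat n n" "r < n" "s < n"
  shows "word_eval n X (l # u) $$ (r, s) =
    (\<Sum>t<n. letter_eval X l $$ (r, t) * word_eval n X u $$ (t, s))"
proof -
  have "letter_eval X l \<in> carrier_mat n n" "word_eval n X u \<in> carrier_mat n n"
    using assms(1) by (simp_all add: letter_eval_carrier word_eval_carrier)
  then show ?thesis using assms(2,3) by (simp add: index_mult_mat_sum[of _ n n _ n] del: index_mult_mat)
qed

text \<open>From \<open>a t\<close> the far end is \<open>length v - t\<close> edges away and the
  word has at most that many letters. So each letter must advance, and the labels met on the way
  spell \<open>drop t v\<close>.\<close>

lemma word_eval_path:
  assumes inj: "inj_on a {..length v}" and range: "a ` {..length v} \<subseteq> {..<n}"
    and "t \<le> length v" "length u \<le> length v - t"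
  shows "word_eval n (path_tuple n a v) u $$ (a t, a (length v)) = (if u = drop t v then 1 else 0)"
  using assms(3,4)
proof (induction u arbitrary: t)
  case Nil
  have "a t < n" "a (length v) < n" using range Nil by auto
  moreover have "a t = a (length v) \<longleftrightarrow> t = length v" using inj_on_eq_iff[OF inj] Nil by simp
  moreover have "[] = drop t v \<longleftrightarrow> t = length v" using Nil by auto
  ultimately show ?case by auto
next
  case (Cons l u)
  let ?k = "length v"
  have t: "t < ?k" using Cons.prems by auto
  have lt: "a s < n" if "s \<le> ?k" for s using range that by auto
  have eq: "a r = a s \<longleftrightarrow> r = s" if "r \<le> ?k" "s \<le> ?k" for r s
    using inj_on_eq_iff[OF inj] that by simp
  let ?L = "letter_eval (path_tuple n a v) l" and ?M = "word_eval n (path_tuple n a v) u"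
  \<comment> \<open>The only other neighbour of \<open>a t\<close> is its predecessor. After a step
    back, the remaining letters are too few to reach the end.\<close>
  have zero: "?L $$ (a t, s) * ?M $$ (s, a ?k) = 0" if s: "s < n" "s \<noteq> a (Suc t)" for s
  proof (rule ccontr)
    assume nz: "?L $$ (a t, s) * ?M $$ (s, a ?k) \<noteq> 0"
    then have "?L $$ (a t, s) \<noteq> 0" by simp
    then obtain t' where t': "t' < ?k" "(a t = a t' \<and> s = a (Suc t')) \<or> (a t = a (Suc t') \<and> s = a t')"
      using index_letter_eval_path[of "a t" n s a v l] lt[of t] t s(1) by (auto split: if_splits)
    then have st: "t = Suc t'" "s = a t'" using s(2) eq t by auto
    have "?M $$ (a t', a ?k) = (if u = drop t' v then 1 else 0)"
      by (rule Cons.IH) (use st t Cons.prems in auto)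
    moreover have "u \<noteq> drop t' v" using Cons.prems st t by (auto dest: arg_cong[of _ _ length])
    ultimately show False using nz st by simp
  qed
  have "word_eval n (path_tuple n a v) (l # u) $$ (a t, a ?k) = (\<Sum>s<n. ?L $$ (a t, s) * ?M $$ (s, a ?k))"
    by (rule word_eval_Cons_index) (use lt t in auto)
  also have "\<dots> = (\<Sum>s<n. if s = a (Suc t) then ?L $$ (a t, a (Suc t)) * ?M $$ (a (Suc t), a ?k) else 0)"
    by (rule sum.cong) (use zero in auto)
  also have "\<dots> = ?L $$ (a t, a (Suc t)) * ?M $$ (a (Suc t), a ?k)" using lt[of "Suc t"] t by simp
  also have "?L $$ (a t, a (Suc t)) = (if v ! t = l then 1 else 0)"
    using index_letter_eval_path[of "a t" n "a (Suc t)" a v l] lt[of t] lt[of "Suc t"] t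
    by (auto simp: eq)
  also have "?M $$ (a (Suc t), a ?k) = (if u = drop (Suc t) v then 1 else 0)"
    by (rule Cons.IH) (use t Cons.prems in auto)
  finally have "word_eval n (path_tuple n a v) (l # u) $$ (a t, a ?k) =
      (if v ! t = l then 1 else 0) * (if u = drop (Suc t) v then 1 else 0)" .
  moreover have "l # u = drop t v \<longleftrightarrow> v ! t = l \<and> u = drop (Suc t) v"
    using Cons_nth_drop_Suc[OF t, symmetric] by auto
  ultimately show ?case by (simp del: word_eval.simps)
qed

text \<open>Consecutive letters of a word meet in a vertex, so the regions of their indices
  intersect and therefore coincide. With constant \<open>R\<close> this keeps a nonempty word on its
  path; with disjoint regions it makes a word that uses both vanish.\<close>

lemma word_eval_support:
  assumes X: "\<And>i. X i \<in> carrier_mat n n"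
    and L: "\<And>l r s. r < n \<Longrightarrow> s < n \<Longrightarrow> letter_eval X l $$ (r, s) \<noteq> 0 \<Longrightarrow>
      r \<in> R (letter_index l) \<and> s \<in> R (letter_index l)"
    and R: "\<And>i j. R i \<inter> R j \<noteq> {} \<Longrightarrow> R i = R j"
    and "r < n" "s < n" "word_eval n X u $$ (r, s) \<noteq> 0" "l \<in> set u"
  shows "r \<in> R (letter_index l) \<and> s \<in> R (letter_index l)"
  using assms(4-)
proof (induction u arbitrary: r l)
  case (Cons m u)
  have "(\<Sum>t<n. letter_eval X m $$ (r, t) * word_eval n X u $$ (t, s)) \<noteq> 0"
    using Cons.prems word_eval_Cons_index[OF X Cons.prems(1,2)] by simp
  then obtain t where "t < n" "letter_eval X m $$ (r, t) * word_eval n X u $$ (t, s) \<noteq> 0"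
    by (metis (mono_tags, lifting) lessThan_iff sum.neutral)
  then have t: "t < n" "letter_eval X m $$ (r, t) \<noteq> 0" "word_eval n X u $$ (t, s) \<noteq> 0" by auto
  have m: "r \<in> R (letter_index m)" "t \<in> R (letter_index m)" using L[OF Cons.prems(1) t(1,2)] by auto
  have u: "t \<in> R (letter_index l) \<and> s \<in> R (letter_index l)" if "l \<in> set u" for l
    using Cons.IH[OF t(1) Cons.prems(2) t(3) that] .
  have same: "R (letter_index l) = R (letter_index m)" if "l \<in> set u" for l
    using u[OF that] m(2) by (intro R) auto
  have s: "s \<in> R (letter_index m)"
  proof (cases u)
    case Nil
    then have "s = t" using t Cons.prems(2) by (auto split: if_splits)
    then show ?thesis using m by simp
  next
    case (Cons l' u')
    then show ?thesis using u[of l'] same[of l'] by simp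
  qed
  show ?case using Cons.prems(4) m(1) s same by auto
qed simp

lemma letter_eval_path_support:
  assumes "r < n" "s < n" "letter_eval (path_tuple n a v) l $$ (r, s) \<noteq> 0"
  shows "r \<in> a ` {..length v} \<and> s \<in> a ` {..length v}"
  using assms index_letter_eval_path[OF assms(1,2), of a v l] by (auto split: if_splits)

text \<open>The flag lets one statement with two flags cover all four products of two matrices or
  their adjoints.\<close>

definition adj_if :: "bool \<Rightarrow> complex mat \<Rightarrow> complex mat" where
  "adj_if f A = (if f then mat_adjoint A else A)"

lemma adj_if_carrier [simp]: "adj_if f A \<in> carrier_mat n n \<longleftrightarrow> A \<in> carrier_mat n n"
  by (simp add: adj_if_def)

context
  fixes d n :: nat and q :: free_poly and v :: "letter list" and a :: "nat \<Rightarrow> nat"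
  assumes q: "\<And>w. q w \<in> carrier_mat d d" "finite (poly_support d q)"
      "\<And>w. w \<in> poly_support d q \<Longrightarrow> length w = length v"
    and v: "v \<noteq> []"
    and a: "inj_on a {..length v}" "a ` {..length v} \<subseteq> {..<n}"
begin

text \<open>All words of \<open>q\<close> are as long as \<open>v\<close>, and among these only
  \<open>v\<close> leads from the first to the last vertex. Taking the adjoint exchanges the two
  ends, hence the flag in the indices.\<close>

lemma adj_if_poly_eval_path:
  assumes "b < d" "e < d"
  shows "adj_if f (poly_eval d n q (path_tuple n a v)) $$
      (b * n + a (if f then length v else 0), e * n + a (if f then 0 else length v)) = adj_if f (q v) $$ (b, e)"
proof -
  let ?k = "length v"
  have lt: "a 0 < n" "a ?k < n" using a by auto
  have main: "poly_eval d n q (path_tuple n a v) $$ (b * n + a 0, e * n + a ?k) = q v $$ (b, e)"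
    if "b < d" "e < d" for b e
  proof -
    \<comment> \<open>The word \<open>v\<close> is inserted because its coefficient may be zero, in
      which case it is missing from the support.\<close>
    have "poly_eval d n q (path_tuple n a v) $$ (b * n + a 0, e * n + a ?k) =
      (\<Sum>w\<in>insert v (poly_support d q). q w $$ (b, e) * word_eval n (path_tuple n a v) w $$ (a 0, a ?k))"
      by (rule index_poly_eval_block) (use q lt that in auto)
    also have "\<dots> = (\<Sum>w\<in>insert v (poly_support d q). if w = v then q v $$ (b, e) else 0)"
    proof (rule sum.cong[OF refl])
      fix w assume "w \<in> insert v (poly_support d q)"
      then have "length w = ?k" using q(3) by auto
      then show "q w $$ (b, e) * word_eval n (path_tuple n a v) w $$ (a 0, a ?k) =
          (if w = v then q v $$ (b, e) else 0)"
        using word_eval_path[OF a, of 0 w] by simp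
    qed
    also have "\<dots> = q v $$ (b, e)" using q(2) by (simp del: insert_iff add: insertI1)
    finally show ?thesis .
  qed
  show ?thesis
  proof (cases f)
    case True
    have "adj_if f (poly_eval d n q (path_tuple n a v)) $$ (b * n + a ?k, e * n + a 0) =
        cnj (poly_eval d n q (path_tuple n a v) $$ (e * n + a 0, b * n + a ?k))"
      unfolding adj_if_def using True assms lt carrier_matD[OF poly_eval_carrier[of d n q "path_tuple n a v"]]
      by (simp add: block_index_less)
    then show ?thesis using main[OF assms(2,1)] True assms carrier_matD[OF q(1)[of v]] by (simp add: adj_if_def)
  qed (use main assms in \<open>simp add: adj_if_def\<close>)
qed

text \<open>Every word of \<open>q\<close> has a letter, and letters act only along the path. The
  empty word would contribute identity entries off the path; \<open>v\<close> being nonempty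
  excludes it.\<close>

lemma adj_if_poly_eval_path_eq_0:
  assumes "b < d" "e < d" "r < n" "s < n" "r \<notin> a ` {..length v} \<or> s \<notin> a ` {..length v}"
  shows "adj_if f (poly_eval d n q (path_tuple n a v)) $$ (b * n + r, e * n + s) = 0"
proof -
  have main: "poly_eval d n q (path_tuple n a v) $$ (b * n + r, e * n + s) = 0"
    if "b < d" "e < d" "r < n" "s < n" "r \<notin> a ` {..length v} \<or> s \<notin> a ` {..length v}" for b e r s
  proof -
    have "poly_eval d n q (path_tuple n a v) $$ (b * n + r, e * n + s) =
      (\<Sum>w\<in>poly_support d q. q w $$ (b, e) * word_eval n (path_tuple n a v) w $$ (r, s))"
      by (rule index_poly_eval_block) (use q that in auto)
    also have "\<dots> = 0"
    proof (rule sum.neutral, rule ballI)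
      fix w assume "w \<in> poly_support d q"
      then have "length w = length v" by (rule q(3))
      then obtain l where "l \<in> set w" using v by (cases w) auto
      then have "word_eval n (path_tuple n a v) w $$ (r, s) = 0"
        using word_eval_support[of "path_tuple n a v" n "\<lambda>_. a ` {..length v}" r s w l]
          letter_eval_path_support[of _ n _ a v] that by (metis path_tuple_carrier)
      then show "q w $$ (b, e) * word_eval n (path_tuple n a v) w $$ (r, s) = 0" by simp
    qed
    finally show ?thesis .
  qed
  show ?thesis
  proof (cases f)
    case True
    have "adj_if f (poly_eval d n q (path_tuple n a v)) $$ (b * n + r, e * n + s) =
        cnj (poly_eval d n q (path_tuple n a v) $$ (e * n + s, b * n + r))"
      unfolding adj_if_def using True assms carrier_matD[OF poly_eval_carrier[of d n q "path_tuple n a v"]]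
      by (simp add: block_index_less)
    then show ?thesis using main[OF assms(2,1,4,3)] assms(5) by auto
  qed (use main assms in \<open>simp add: adj_if_def\<close>)
qed

end

section \<open>Moving paths by permutation matrices\<close>

definition perm_mat :: "nat \<Rightarrow> (nat \<Rightarrow> nat) \<Rightarrow> complex mat" where
  "perm_mat n \<sigma> = mat n n (\<lambda>(r, s). if r = \<sigma> s then 1 else 0)"

lemma perm_mat_carrier [simp]: "perm_mat n \<sigma> \<in> carrier_mat n n"
  by (simp add: perm_mat_def)

lemma perm_mat_conj:
  assumes "\<And>r. r < n \<Longrightarrow> \<sigma> r < n" "X \<in> carrier_mat n n"
  shows "mat_adjoint (perm_mat n \<sigma>) * X * perm_mat n \<sigma> = mat n n (\<lambda>(r, s). X $$ (\<sigma> r, \<sigma> s))"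
proof (rule eq_matI)
  let ?P = "perm_mat n \<sigma>"
  have P: "mat_adjoint ?P \<in> carrier_mat n n" by simp
  have Pe: "?P $$ (i, j) = (if i = \<sigma> j then 1 else 0)" if "i < n" "j < n" for i j
    using that by (simp add: perm_mat_def)
  fix r s assume "r < dim_row (mat n n (\<lambda>(r, s). X $$ (\<sigma> r, \<sigma> s)))"
    "s < dim_col (mat n n (\<lambda>(r, s). X $$ (\<sigma> r, \<sigma> s)))"
  then have rs: "r < n" "s < n" by auto
  have left: "(mat_adjoint ?P * X) $$ (r, k) = X $$ (\<sigma> r, k)" if "k < n" for k
  proof -
    have "(mat_adjoint ?P * X) $$ (r, k) = (\<Sum>i<n. mat_adjoint ?P $$ (r, i) * X $$ (i, k))"
      by (rule index_mult_mat_sum[OF P assms(2) rs(1) that])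
    also have "\<dots> = (\<Sum>i<n. if i = \<sigma> r then X $$ (\<sigma> r, k) else 0)"
      using rs carrier_matD[OF perm_mat_carrier[of n \<sigma>]]
      by (intro sum.cong refl) (simp add: Pe)
    finally show ?thesis using assms(1)[OF rs(1)] by simp
  qed
  have "(mat_adjoint ?P * X * ?P) $$ (r, s) = (\<Sum>k<n. (mat_adjoint ?P * X) $$ (r, k) * ?P $$ (k, s))"
    by (rule index_mult_mat_sum[OF mult_carrier_mat[OF P assms(2)] perm_mat_carrier rs])
  also have "\<dots> = (\<Sum>k<n. if k = \<sigma> s then X $$ (\<sigma> r, \<sigma> s) else 0)"
    using rs by (intro sum.cong refl) (simp add: left Pe del: index_mult_mat)
  also have "\<dots> = X $$ (\<sigma> r, \<sigma> s)" using assms(1)[OF rs(2)] by simp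
  finally show "(mat_adjoint ?P * X * ?P) $$ (r, s) = mat n n (\<lambda>(r, s). X $$ (\<sigma> r, \<sigma> s)) $$ (r, s)"
    using rs by simp
qed (use assms in \<open>auto simp: perm_mat_def\<close>)

lemma unitary_perm_mat:
  assumes "\<And>r. r < n \<Longrightarrow> \<sigma> r < n" "\<And>r. \<sigma> (\<sigma> r) = r"
  shows "unitary_mat n (perm_mat n \<sigma>)"
proof -
  have inj: "\<sigma> r = \<sigma> s \<longleftrightarrow> r = s" for r s using assms(2) by metis
  have "mat_adjoint (perm_mat n \<sigma>) * 1\<^sub>m n * perm_mat n \<sigma> = mat n n (\<lambda>(r, s). 1\<^sub>m n $$ (\<sigma> r, \<sigma> s))"
    by (rule perm_mat_conj) (use assms in auto)
  also have "\<dots> = 1\<^sub>m n" by (rule eq_matI) (use assms(1) inj in auto)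
  also have "mat_adjoint (perm_mat n \<sigma>) * 1\<^sub>m n = mat_adjoint (perm_mat n \<sigma>)"
    by (rule right_mult_one_mat[of _ n n]) simp
  finally show ?thesis
    unfolding unitary_mat_def using mat_mult_left_right_inverse[of "mat_adjoint (perm_mat n \<sigma>)" n "perm_mat n \<sigma>"]
    by simp
qed

text \<open>Conjugation reads the entry at \<open>(\<sigma> r, \<sigma> s)\<close>, so it moves
  vertices by the inverse of \<sigma>, which is \<sigma> itself for an involution.\<close>

lemma path_tuple_perm:
  assumes "\<And>r. r < n \<Longrightarrow> \<sigma> r < n" "\<And>r. \<sigma> (\<sigma> r) = r"
  shows "mat_adjoint (perm_mat n \<sigma>) * path_tuple n a v j * perm_mat n \<sigma> = path_tuple n (\<sigma> \<circ> a) v j"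
proof -
  have swap: "\<sigma> r = s \<longleftrightarrow> r = \<sigma> s" for r s using assms(2) by metis
  have "mat_adjoint (perm_mat n \<sigma>) * path_tuple n a v j * perm_mat n \<sigma> =
      mat n n (\<lambda>(r, s). path_tuple n a v j $$ (\<sigma> r, \<sigma> s))"
    by (rule perm_mat_conj) (use assms in auto)
  also have "\<dots> = path_tuple n (\<sigma> \<circ> a) v j"
    by (rule eq_matI) (auto simp: path_tuple_def assms(1) swap)
  finally show ?thesis .
qed

lemma path_tuple_no_letter:
  assumes "\<And>l. l \<in> set v \<Longrightarrow> letter_index l \<noteq> j"
  shows "path_tuple n a v j = 0\<^sub>m n n"
proof -
  have "v ! t \<noteq> Var j" "v ! t \<noteq> Adj j" if "t < length v" for t
    using assms[OF nth_mem[OF that]] by auto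
  then show ?thesis by (intro eq_matI) (auto simp: path_tuple_def)
qed

section \<open>Consequences of invariance\<close>

lemma weight_indicator:
  "weight (\<lambda>j. if j = i then 1 else 0) w = length (filter (\<lambda>l. letter_index l = i) w)"
  by (induction w) (auto simp: weight_def)

lemma weight_one: "weight (\<lambda>_. Suc 0) w = length w"
  by (induction w) (auto simp: weight_def)

text \<open>Conjugation by one fixed \<open>W\<close> respects products; this is how the vanishing
  of a product passes through the invariance relation.\<close>

lemma unitary_conj_cancel:
  assumes "unitary_mat N W" "A \<in> carrier_mat N N" "B \<in> carrier_mat N N"
  shows "(mat_adjoint W * A * W) * (mat_adjoint W * B * W) = mat_adjoint W * (A * B) * W"
proof -
  have c: "W \<in> carrier_mat N N" "mat_adjoint W \<in> carrier_mat N N"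
    using assms(1) by (auto simp: unitary_mat_def)
  note a = assoc_mult_mat[of _ N N _ N _ N]
  have "(mat_adjoint W * A * W) * (mat_adjoint W * B * W) =
      mat_adjoint W * (A * (W * (mat_adjoint W * (B * W))))"
    using c assms by (simp add: a)
  also have "W * (mat_adjoint W * (B * W)) = B * W"
    by (rule unitary_cancel(1)[OF assms(1)]) (use c assms in auto)
  also have "mat_adjoint W * (A * (B * W)) = mat_adjoint W * (A * B) * W"
    using c assms by (simp add: a)
  finally show ?thesis .
qed

lemma unitary_conj_inverse:
  assumes "unitary_mat N W" "A \<in> carrier_mat N N"
  shows "W * (mat_adjoint W * A * W) * mat_adjoint W = A"
proof -
  have c: "W \<in> carrier_mat N N" "mat_adjoint W \<in> carrier_mat N N"
    using assms(1) by (auto simp: unitary_mat_def)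
  note a = assoc_mult_mat[of _ N N _ N _ N]
  have "W * (mat_adjoint W * A * W) * mat_adjoint W = W * (mat_adjoint W * (A * (W * mat_adjoint W)))"
    using c assms by (simp add: a)
  also have "\<dots> = A * (W * mat_adjoint W)"
    by (rule unitary_cancel(1)[OF assms(1)]) (use c assms in auto)
  finally show ?thesis using assms by (simp add: unitary_mat_def)
qed

lemma unitary_conj_eq_0:
  assumes "unitary_mat N W" "A \<in> carrier_mat N N" "mat_adjoint W * A * W = 0\<^sub>m N N"
  shows "A = 0\<^sub>m N N"
  using unitary_conj_inverse[OF assms(1,2)] assms by (auto simp: unitary_mat_def)

lemma adj_if_conj:
  assumes "W \<in> carrier_mat N N" "A \<in> carrier_mat N N"
  shows "adj_if f (mat_adjoint W * A * W) = mat_adjoint W * adj_if f A * W"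
proof (cases f)
  case True
  have "mat_adjoint (mat_adjoint W * A * W) = mat_adjoint W * mat_adjoint (mat_adjoint W * A)"
    by (rule mat_adjoint_mult[of _ N N _ N]) (use assms in \<open>auto intro!: mult_carrier_mat[of _ N N]\<close>)
  also have "mat_adjoint (mat_adjoint W * A) = mat_adjoint A * W"
    using mat_adjoint_mult[of "mat_adjoint W" N N A N] assms by simp
  also have "mat_adjoint W * (mat_adjoint A * W) = mat_adjoint W * mat_adjoint A * W"
    using assoc_mult_mat[of "mat_adjoint W" N N "mat_adjoint A" N W N] assms by simp
  finally show ?thesis using True by (simp add: adj_if_def)
qed (simp add: adj_if_def)

context
  fixes g d :: nat and p :: free_poly
  assumes free: "free_mat_poly {..<g} d p" and inv: "coord_unitary_invariant g d p"
begin

lemma coeff_carrier: "p w \<in> carrier_mat d d"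
  using free by (simp add: free_mat_poly_def)

lemma finite_support: "finite (poly_support d p)"
  using free by (simp add: free_mat_poly_def)

lemma obtain_intertwiner:
  assumes "\<And>i. unitary_mat n (U i)"
  obtains W where "unitary_mat (d * n) W" "intertwines d n p U W"
  using inv assms unfolding coord_unitary_invariant_def intertwines_def by meson

text \<open>The part of \<open>p\<close> singled out fixes the length and the number of letters with
  the index of \<open>l\<close>. That number is positive and smaller than the length, so every word
  of the part is mixed and has to use two regions that the conjugation has made disjoint.\<close>

lemma mixed_coeff_eq_0:
  assumes l: "l \<in> set w" "l' \<in> set w" "letter_index l \<noteq> letter_index l'"
  shows "p w = 0\<^sub>m d d"
proof -
  let ?k = "length w" and ?i = "letter_index l"
  \<comment> \<open>Two copies of the \<open>length w + 1\<close> vertices of the path; \<sigma>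
    exchanges them.\<close>
  define n where "n = 2 * Suc ?k"
  define \<sigma> where "\<sigma> r = (if r \<le> ?k then r + Suc ?k else if r < n then r - Suc ?k else r)" for r
  have \<sigma>: "\<And>r. r < n \<Longrightarrow> \<sigma> r < n" "\<And>r. \<sigma> (\<sigma> r) = r" by (auto simp: \<sigma>_def n_def)
  define U where "U j = (if j = ?i then perm_mat n \<sigma> else 1\<^sub>m n)" for j
  have U: "unitary_mat n (U j)" for j using unitary_perm_mat[OF \<sigma>] by (simp add: U_def)
  have Uc: "U j \<in> carrier_mat n n" for j by (simp add: U_def)
  obtain W where W: "unitary_mat (d * n) W" "intertwines d n p U W" using obtain_intertwiner[OF U] .
  have Wc: "W \<in> carrier_mat (d * n) (d * n)" using W by (simp add: unitary_mat_def)
  let ?c = "\<lambda>j. if j = ?i then 1 else 0 :: nat"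
  define m where "m = weight ?c w"
  define q1 where "q1 = restrict_poly d (\<lambda>u. weight ?c u = m) p"
  define q where "q = restrict_poly d (\<lambda>u. weight (\<lambda>_. 1) u = ?k) q1"
  have q1: "q1 u \<in> carrier_mat d d" "finite (poly_support d q1)" for u
    using coeff_carrier finite_support by (auto simp: q1_def restrict_poly_carrier poly_support_restrict)
  have q: "q u \<in> carrier_mat d d" "finite (poly_support d q)" for u
    using q1 by (auto simp: q_def restrict_poly_carrier poly_support_restrict)
  have qs: "length u = ?k" "weight ?c u = m" if "u \<in> poly_support d q" for u
    using that by (auto simp: q_def q1_def poly_support_restrict weight_one)
  have "intertwines d n q1 U W"
    unfolding q1_def by (rule intertwines_restrict[OF coeff_carrier finite_support Uc Wc W(2)])
  then have rel: "intertwines d n q U W"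
    unfolding q_def by (rule intertwines_restrict[OF q1 Uc Wc])
  let ?X = "path_tuple n id w"
  define Y where "Y j = mat_adjoint (U j) * ?X j * U j" for j
  have Yi: "Y ?i = path_tuple n (\<sigma> \<circ> id) w ?i"
    unfolding Y_def U_def by (simp only: if_True path_tuple_perm[OF \<sigma>] refl)
  have Yj: "Y j = ?X j" if "j \<noteq> ?i" for j
    using that by (simp add: Y_def U_def left_mult_one_mat[OF path_tuple_carrier]
        right_mult_one_mat[OF path_tuple_carrier])
  have Yc: "Y j \<in> carrier_mat n n" for j by (cases "j = ?i") (auto simp: Yi Yj)
  \<comment> \<open>After the conjugation, edges with the index of \<open>l\<close> lie in the
    second copy, and all other edges have stayed in the first.\<close>
  define R where "R j = (if j = ?i then \<sigma> ` {..?k} else {..?k})" for j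
  have disj: "\<sigma> ` {..?k} \<inter> {..?k} = {}" by (auto simp: \<sigma>_def)
  have YR: "r \<in> R (letter_index h) \<and> s \<in> R (letter_index h)"
    if rs: "r < n" "s < n" "letter_eval Y h $$ (r, s) \<noteq> 0" for h r s
  proof (cases "letter_index h = ?i")
    case True
    then have "letter_eval Y h = letter_eval (path_tuple n (\<sigma> \<circ> id) w) h"
      using Yi by (cases h) auto
    then show ?thesis
      using letter_eval_path_support[of r n s "\<sigma> \<circ> id" w h] rs True by (simp add: R_def image_comp)
  next
    case False
    then have "letter_eval Y h = letter_eval ?X h" using Yj by (cases h) auto
    then show ?thesis
      using letter_eval_path_support[of r n s id w h] rs False by (simp add: R_def)
  qed
  have R: "R i = R j" if "R i \<inter> R j \<noteq> {}" for i j using that disj by (auto simp: R_def split: if_splits)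
  have word0: "word_eval n Y u $$ (r, s) = 0"
    if u: "u \<in> poly_support d q" and rs: "r < n" "s < n" for u r s
  proof (rule ccontr)
    assume nz: "word_eval n Y u $$ (r, s) \<noteq> 0"
    have cnt: "length (filter (\<lambda>h. letter_index h = ?i) u) = length (filter (\<lambda>h. letter_index h = ?i) w)"
      using qs(2)[OF u] by (simp add: m_def weight_indicator)
    have "filter (\<lambda>h. letter_index h = ?i) w \<noteq> []" using l(1) by (auto simp: filter_empty_conv)
    then have "filter (\<lambda>h. letter_index h = ?i) u \<noteq> []" using cnt by auto
    then obtain h where h: "h \<in> set u" "letter_index h = ?i" by (auto simp: filter_empty_conv)
    have "length (filter (\<lambda>h. letter_index h = ?i) w) < ?k"
      using l by (intro length_filter_less[of l']) auto
    then have "filter (\<lambda>h. letter_index h = ?i) u \<noteq> u" using cnt qs(1)[OF u] by auto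
    then obtain h' where h': "h' \<in> set u" "letter_index h' \<noteq> ?i" by (auto simp: filter_id_conv)
    have "r \<in> R (letter_index h)" "r \<in> R (letter_index h')"
      using word_eval_support[where R = R, OF Yc YR R rs nz h(1)]
        word_eval_support[where R = R, OF Yc YR R rs nz h'(1)] by auto
    then show False using h h' disj by (auto simp: R_def)
  qed
  have "poly_eval d n q Y = 0\<^sub>m (d * n) (d * n)"
  proof (rule block_mat_eqI[OF poly_eval_carrier zero_carrier_mat])
    fix a r b s assume i: "a < d" "r < n" "b < d" "s < n"
    have "poly_eval d n q Y $$ (a * n + r, b * n + s) =
        (\<Sum>u\<in>poly_support d q. q u $$ (a, b) * word_eval n Y u $$ (r, s))"
      by (rule index_poly_eval_block) (use q i Yc word_eval_carrier in auto)
    then show "poly_eval d n q Y $$ (a * n + r, b * n + s) = 0\<^sub>m (d * n) (d * n) $$ (a * n + r, b * n + s)"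
      using word0 i by (simp add: block_index_less)
  qed
  moreover have "poly_eval d n q Y = mat_adjoint W * poly_eval d n q ?X * W"
    using rel unfolding intertwines_def Y_def by simp
  ultimately have zero: "poly_eval d n q ?X = 0\<^sub>m (d * n) (d * n)"
    using unitary_conj_eq_0[OF W(1) poly_eval_carrier] by simp
  have "q w = 0\<^sub>m d d"
  proof (rule eq_matI)
    fix b e assume "b < dim_row (0\<^sub>m d d)" "e < dim_col (0\<^sub>m d d)"
    then have be: "b < d" "e < d" by auto
    have "adj_if False (poly_eval d n q ?X) $$ (b * n + id (if False then ?k else 0), e * n + id (if False then 0 else ?k)) =
        adj_if False (q w) $$ (b, e)"
      by (rule adj_if_poly_eval_path) (use q qs l be in \<open>auto simp: n_def\<close>)
    then show "q w $$ (b, e) = 0\<^sub>m d d $$ (b, e)"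
      using zero be block_index_less[of b d 0 n] block_index_less[of e d ?k n] by (simp add: adj_if_def n_def)
  qed (use q in auto)
  then show ?thesis by (simp add: q_def q1_def restrict_poly_def m_def weight_one)
qed

text \<open>Both homogeneous parts are conjugated by the same \<open>W\<close>, so the zero product
  for disjoint paths remains zero once the path of \<open>w\<close> has been attached to that of
  \<open>v\<close>. The inner sum of the matrix product then runs through the shared vertex only and
  leaves the product of the two coefficients.\<close>

lemma pure_coeffs_orthogonal:
  assumes v: "v \<noteq> []" "\<And>l. l \<in> set v \<Longrightarrow> letter_index l = i"
    and w: "w \<noteq> []" "\<And>l. l \<in> set w \<Longrightarrow> letter_index l = j" and ij: "i \<noteq> j"
  shows "adj_if f (p v) * adj_if f' (p w) = 0\<^sub>m d d"
proof -
  let ?k = "length v" and ?l = "length w"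
  \<comment> \<open>The path of \<open>v\<close> uses the vertices \<open>0\<close> to
    \<open>?k\<close>, that of \<open>w\<close> the next \<open>?l + 1\<close> vertices.\<close>
  define n where "n = ?k + ?l + 2"
  define b where "b t = Suc ?k + t" for t
  \<comment> \<open>In the left factor the coefficient of \<open>v\<close> sits in the column of
    vertex \<open>x\<close>, in the right factor that of \<open>w\<close> sits in the row of vertex
    \<open>y\<close>; adjoints exchange ends. Identifying \<open>y\<close> with \<open>x\<close>
    makes the matrix product pair these two entries.\<close>
  define x where "x = (if f then 0 else ?k)"
  define y where "y = b (if f' then ?l else 0)"
  define \<sigma> where "\<sigma> r = (if r = x then y else if r = y then x else r)" for r
  have \<sigma>: "\<And>r. r < n \<Longrightarrow> \<sigma> r < n" "\<And>r. \<sigma> (\<sigma> r) = r"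
    by (auto simp: \<sigma>_def n_def x_def y_def b_def)
  have inj: "inj_on b {..?l}" "b ` {..?l} \<subseteq> {..<n}" "inj_on (\<sigma> \<circ> b) {..?l}" "(\<sigma> \<circ> b) ` {..?l} \<subseteq> {..<n}"
  proof -
    show 1: "inj_on b {..?l}" "b ` {..?l} \<subseteq> {..<n}" by (auto simp: b_def n_def inj_on_def)
    have "inj \<sigma>" using \<sigma>(2) by (metis injI)
    then show "inj_on (\<sigma> \<circ> b) {..?l}" using 1(1) by (auto intro!: comp_inj_on inj_on_subset[of \<sigma> UNIV])
    show "(\<sigma> \<circ> b) ` {..?l} \<subseteq> {..<n}" using 1(2) \<sigma>(1) by auto
  qed
  \<comment> \<open>Only the variable of \<open>w\<close> is conjugated, so the path of
    \<open>v\<close> stays in place.\<close>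
  define U where "U m = (if m = j then perm_mat n \<sigma> else 1\<^sub>m n)" for m
  have U: "unitary_mat n (U m)" for m using unitary_perm_mat[OF \<sigma>] by (simp add: U_def)
  have Uc: "U m \<in> carrier_mat n n" for m by (simp add: U_def)
  obtain W where W: "unitary_mat (d * n) W" "intertwines d n p U W" using obtain_intertwiner[OF U] .
  have Wc: "W \<in> carrier_mat (d * n) (d * n)" using W by (simp add: unitary_mat_def)
  define q where "q m = restrict_poly d (\<lambda>u. weight (\<lambda>_. 1) u = m) p" for m
  have q: "q m u \<in> carrier_mat d d" "finite (poly_support d (q m))" for m u
    using coeff_carrier finite_support by (auto simp: q_def restrict_poly_carrier poly_support_restrict)
  have qs: "length u = m" if "u \<in> poly_support d (q m)" for u m
    using that by (auto simp: q_def poly_support_restrict weight_one)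
  have qp: "q (length u) u = p u" for u by (simp add: q_def restrict_poly_def weight_one)
  have rel: "intertwines d n (q m) U W" for m
    unfolding q_def by (rule intertwines_restrict[OF coeff_carrier finite_support Uc Wc W(2)])
  have fixX: "mat_adjoint (U m) * path_tuple n id v m * U m = path_tuple n id v m" for m
  proof (cases "m = j")
    case True
    then have "path_tuple n id v m = 0\<^sub>m n n" using v(2) ij by (intro path_tuple_no_letter) auto
    then show ?thesis using Uc[of m] by simp
  next
    case False
    then show ?thesis
      by (simp add: U_def left_mult_one_mat[OF path_tuple_carrier] right_mult_one_mat[OF path_tuple_carrier])
  qed
  have moveY: "mat_adjoint (U m) * path_tuple n b w m * U m = path_tuple n (\<sigma> \<circ> b) w m" for m
  proof (cases "m = j")
    case True
    show ?thesis unfolding U_def by (simp only: True if_True path_tuple_perm[OF \<sigma>] refl)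
  next
    case False
    then have "path_tuple n a w m = 0\<^sub>m n n" for a using w(2) by (intro path_tuple_no_letter) auto
    then show ?thesis using Uc[of m] by simp
  qed
  let ?N = "d * n"
  let ?P = "poly_eval d n (q ?k) (path_tuple n id v)"
  let ?Q = "poly_eval d n (q ?l) (path_tuple n b w)" and ?Q' = "poly_eval d n (q ?l) (path_tuple n (\<sigma> \<circ> b) w)"
  have P: "?P = mat_adjoint W * ?P * W"
    using rel[of ?k] fixX unfolding intertwines_def by (metis (no_types, lifting) ext path_tuple_carrier)
  have Q: "?Q' = mat_adjoint W * ?Q * W"
    using rel[of ?l] moveY unfolding intertwines_def by (metis (no_types, lifting) ext path_tuple_carrier)
  have oc: "adj_if h (poly_eval d n q' X) \<in> carrier_mat ?N ?N" for h q' X by simp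
  have P0: "adj_if f ?P $$ (a * n + r, e * n + t) = 0"
    if "a < d" "r < n" "e < d" "t < n" "t \<notin> {..?k}" for a r e t
    by (rule adj_if_poly_eval_path_eq_0) (use q qs v(1) that in \<open>auto simp: n_def\<close>)
  have Q0: "adj_if f' (poly_eval d n (q ?l) (path_tuple n a w)) $$ (e * n + t, c * n + s) = 0"
    if "e < d" "t < n" "c < d" "s < n" "t \<notin> a ` {..?l}" "inj_on a {..?l}" "a ` {..?l} \<subseteq> {..<n}" for e t c s a
    by (rule adj_if_poly_eval_path_eq_0) (use q qs w(1) that in auto)
  have prod: "(adj_if f ?P * adj_if f' (poly_eval d n q' X)) $$ (a * n + r, c * n + s) =
      (\<Sum>e<d. \<Sum>t<n. adj_if f ?P $$ (a * n + r, e * n + t) * adj_if f' (poly_eval d n q' X) $$ (e * n + t, c * n + s))"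
    if "a < d" "r < n" "c < d" "s < n" for a r c s q' X
    unfolding index_mult_mat_sum[OF oc oc block_index_less[OF that(1,2)] block_index_less[OF that(3,4)]]
    by (rule sum_block)
  have "adj_if f ?P * adj_if f' ?Q = 0\<^sub>m ?N ?N"
  proof (rule block_mat_eqI[OF mult_carrier_mat[OF oc oc] zero_carrier_mat])
    fix a r c s assume i: "a < d" "r < n" "c < d" "s < n"
    \<comment> \<open>A nonzero term would need an inner vertex \<open>t\<close> on both paths, and
      these are still disjoint.\<close>
    have "adj_if f ?P $$ (a * n + r, e * n + t) * adj_if f' ?Q $$ (e * n + t, c * n + s) = 0"
      if "e < d" "t < n" for e t
    proof (cases "t \<le> ?k")
      case True
      then have "t \<notin> b ` {..?l}" by (auto simp: b_def)
      then show ?thesis using Q0[of e t c s b] that i inj by simp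
    next
      case False
      then show ?thesis using P0[of a r e t] that i by simp
    qed
    then show "(adj_if f ?P * adj_if f' ?Q) $$ (a * n + r, c * n + s) = 0\<^sub>m ?N ?N $$ (a * n + r, c * n + s)"
      unfolding prod[OF i] index_zero_mat(1)[OF block_index_less[OF i(1,2)] block_index_less[OF i(3,4)]]
      by (intro sum.neutral ballI) simp
  qed
  moreover have "adj_if f ?P * adj_if f' ?Q' = mat_adjoint W * (adj_if f ?P * adj_if f' ?Q) * W"
    using unitary_conj_cancel[OF W(1) oc oc, of f _ _ f'] adj_if_conj[OF Wc poly_eval_carrier] P Q by metis
  ultimately have zero: "adj_if f ?P * adj_if f' ?Q' = 0\<^sub>m ?N ?N" using Wc by simp
  show ?thesis
  proof (rule eq_matI)
    fix a c assume "a < dim_row (0\<^sub>m d d)" "c < dim_col (0\<^sub>m d d)"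
    then have ac: "a < d" "c < d" by auto
    define r where "r = (if f then ?k else 0)"
    define s where "s = (\<sigma> \<circ> b) (if f' then 0 else ?l)"
    have sx: "(\<sigma> \<circ> b) (if f' then ?l else 0) = x" by (auto simp: \<sigma>_def y_def)
    have lt: "r < n" "s < n" "x < n" using \<sigma>(1) by (auto simp: r_def s_def b_def n_def x_def)
    have only_x: "adj_if f ?P $$ (a * n + r, e * n + t) * adj_if f' ?Q' $$ (e * n + t, c * n + s) =
        (if t = x then adj_if f (p v) $$ (a, e) * adj_if f' (p w) $$ (e, c) else 0)"
      if e: "e < d" and t: "t < n" for e t
    proof (cases "t = x")
      case True
      have "adj_if f ?P $$ (a * n + id (if f then ?k else 0), e * n + id (if f then 0 else ?k)) =
          adj_if f (q ?k v) $$ (a, e)"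
        by (rule adj_if_poly_eval_path) (use q qs v(1) ac e in \<open>auto simp: n_def\<close>)
      then have "adj_if f ?P $$ (a * n + r, e * n + x) = adj_if f (p v) $$ (a, e)" by (simp add: r_def x_def qp)
      moreover have "adj_if f' ?Q' $$
          (e * n + (\<sigma> \<circ> b) (if f' then ?l else 0), c * n + (\<sigma> \<circ> b) (if f' then 0 else ?l)) =
          adj_if f' (q ?l w) $$ (e, c)"
        by (rule adj_if_poly_eval_path) (use q qs w(1) ac e inj in auto)
      then have "adj_if f' ?Q' $$ (e * n + x, c * n + s) = adj_if f' (p w) $$ (e, c)"
        unfolding sx s_def[symmetric] qp .
      ultimately show ?thesis using True by simp
    next
      case False
      show ?thesis
      proof (cases "t \<le> ?k")
        case True
        \<comment> \<open>The only vertex of the second path that \<sigma> moves is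
          \<open>y\<close>, and it goes to \<open>x\<close>, so the paths now share \<open>x\<close>
          alone.\<close>
        have "t \<notin> (\<sigma> \<circ> b) ` {..?l}"
        proof
          assume "t \<in> (\<sigma> \<circ> b) ` {..?l}"
          then obtain u where "t = \<sigma> (b u)" by auto
          moreover have "x \<le> ?k" "?k < y" by (auto simp: x_def y_def b_def)
          ultimately show False using True False by (auto simp: \<sigma>_def b_def split: if_splits)
        qed
        then show ?thesis using Q0[of e t c s "\<sigma> \<circ> b"] e t ac lt inj False by simp
      next
        case False
        then show ?thesis using P0[of a r e t] e t ac lt \<open>t \<noteq> x\<close> by simp
      qed
    qed
    have oc': "adj_if f (p v) \<in> carrier_mat d d" "adj_if f' (p w) \<in> carrier_mat d d"
      using coeff_carrier by auto
    have "(adj_if f (p v) * adj_if f' (p w)) $$ (a, c) = (\<Sum>e<d. adj_if f (p v) $$ (a, e) * adj_if f' (p w) $$ (e, c))"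
      by (rule index_mult_mat_sum[OF oc' ac])
    also have "\<dots> = (\<Sum>e<d. \<Sum>t<n. adj_if f ?P $$ (a * n + r, e * n + t) * adj_if f' ?Q' $$ (e * n + t, c * n + s))"
      using only_x lt(3) by simp
    also have "\<dots> = (adj_if f ?P * adj_if f' ?Q') $$ (a * n + r, c * n + s)"
      by (rule prod[symmetric]) (use ac lt in auto)
    also have "\<dots> = 0" unfolding zero using ac lt by (simp add: block_index_less)
    finally show "(adj_if f (p v) * adj_if f' (p w)) $$ (a, c) = 0\<^sub>m d d $$ (a, c)" using ac by simp
  qed (use coeff_carrier[of v] coeff_carrier[of w] in \<open>auto simp: adj_if_def\<close>)
qed

end

section \<open>The block decomposition\<close>

text \<open>The empty word would be pure for every index at once, and its coefficient, the identity,
  is not orthogonal to the others.\<close>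

definition pure_words :: "nat \<Rightarrow> letter list set" where
  "pure_words i = {w. w \<noteq> [] \<and> (\<forall>l\<in>set w. letter_index l = i)}"

lemma cscalar_prod_adjoint:
  fixes A :: "complex mat"
  assumes "A \<in> carrier_mat d d" "x \<in> carrier_vec d" "y \<in> carrier_vec d"
  shows "(A *\<^sub>v x) \<bullet>c y = x \<bullet>c (mat_adjoint A *\<^sub>v y)"
proof -
  have left: "(A *\<^sub>v x) $ k = (\<Sum>j<d. A $$ (k, j) * x $ j)" if "k < d" for k
    using that assms by (auto simp: scalar_prod_def atLeast0LessThan intro!: sum.cong)
  have right: "(mat_adjoint A *\<^sub>v y) $ j = (\<Sum>k<d. cnj (A $$ (k, j)) * y $ k)" if "j < d" for j
    using that assms by (auto simp: scalar_prod_def atLeast0LessThan intro!: sum.cong)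
  have Ay: "mat_adjoint A *\<^sub>v y \<in> carrier_vec d" using assms by (intro mult_mat_vec_carrier[of _ d d]) auto
  have "(A *\<^sub>v x) \<bullet>c y = (\<Sum>k<d. \<Sum>j<d. A $$ (k, j) * x $ j * cnj (y $ k))"
    unfolding cscalar_prod_sum[OF assms(3)]
    by (intro sum.cong refl) (simp add: left sum_distrib_right del: index_mult_mat_vec)
  also have "\<dots> = (\<Sum>j<d. \<Sum>k<d. A $$ (k, j) * x $ j * cnj (y $ k))" by (rule sum.swap)
  also have "\<dots> = x \<bullet>c (mat_adjoint A *\<^sub>v y)"
    unfolding cscalar_prod_sum[OF Ay]
    by (intro sum.cong refl) (simp add: right sum_distrib_left mult_ac del: index_mult_mat_vec)
  finally show ?thesis .
qed

lemma adjoint_adj_if: "mat_adjoint (adj_if f A) = adj_if (\<not> f) A"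
  by (simp add: adj_if_def)

lemma zero_mat_mult_vec: "v \<in> carrier_vec n \<Longrightarrow> 0\<^sub>m m n *\<^sub>v v = (0\<^sub>v m :: complex vec)"
  by (rule eq_vecI) auto

lemma gram_zero: "set us \<subseteq> carrier_vec d \<Longrightarrow> gram us (0\<^sub>m d d) = 0\<^sub>m (length us) (length us)"
proof (rule eq_matI)
  fix r s assume us: "set us \<subseteq> carrier_vec d"
    and "r < dim_row (0\<^sub>m (length us) (length us))" "s < dim_col (0\<^sub>m (length us) (length us))"
  then have rs: "r < length us" "s < length us" by auto
  then have "us ! r \<in> carrier_vec d" "us ! s \<in> carrier_vec d" using us nth_mem by blast+
  then show "gram us (0\<^sub>m d d) $$ (r, s) = 0\<^sub>m (length us) (length us) $$ (r, s)"
    using rs by (simp add: gram_def zero_mat_mult_vec)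
qed auto

text \<open>The spans of the \<open>G i\<close> are mutually orthogonal and fill the space. A
  coefficient of index \<open>m\<close> and its adjoint both map into \<open>G m\<close>, so in an
  adapted basis such a coefficient lives in the block \<open>m\<close> alone.\<close>

lemma invariant_imp_decomposable:
  fixes g d :: nat and p :: free_poly
  assumes g: "g \<ge> 1" and free: "free_mat_poly {..<g} d p" and monic: "monic_poly d p"
    and inv: "coord_unitary_invariant g d p"
  obtains V e q where "unitary_mat d V" "\<And>i. i < g \<Longrightarrow> free_mat_poly {i} (e i) (q i)"
    "(\<Sum>i<g. e i) = d" "poly_conj V p = poly_direct_sum g q"
proof -
  have pc: "p w \<in> carrier_mat d d" for w using coeff_carrier[OF free inv] .
  have opc: "adj_if f (p w) \<in> carrier_mat d d" for f w using pc by simp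
  have opv: "adj_if f (p w) *\<^sub>v x \<in> carrier_vec d" if "x \<in> carrier_vec d" for f w x
    using opc that by (rule mult_mat_vec_carrier)
  have words: "p w = 0\<^sub>m d d \<or> w = [] \<or> (\<exists>m<g. w \<in> pure_words m)" for w
  proof (cases "p w = 0\<^sub>m d d \<or> w = []")
    case False
    then have "w \<in> words_in {..<g}" using free by (auto simp: free_mat_poly_def poly_support_def)
    then have "letter_index (hd w) < g"
      using False hd_in_set[of w] by (auto simp: words_in_def image_subset_iff)
    moreover have "letter_index l = letter_index (hd w)" if "l \<in> set w" for l
      using mixed_coeff_eq_0[OF free inv that, of "hd w"] False by auto
    ultimately show ?thesis using False unfolding pure_words_def by blast
  qed blast
  have orth: "adj_if f (p v) *\<^sub>v (adj_if f' (p w) *\<^sub>v x) = 0\<^sub>v d"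
    if "v \<in> pure_words i" "w \<in> pure_words j" "i \<noteq> j" "x \<in> carrier_vec d" for f f' v w i j x
  proof -
    have "adj_if f (p v) *\<^sub>v (adj_if f' (p w) *\<^sub>v x) = (adj_if f (p v) * adj_if f' (p w)) *\<^sub>v x"
      by (rule assoc_mult_mat_vec[symmetric, OF opc opc that(4)])
    also have "adj_if f (p v) * adj_if f' (p w) = 0\<^sub>m d d"
      by (rule pure_coeffs_orthogonal[OF free inv, of v i w j]) (use that in \<open>auto simp: pure_words_def\<close>)
    finally show ?thesis using that(4) by (simp add: zero_mat_mult_vec)
  qed
  define R where "R i = {adj_if f (p w) *\<^sub>v x | f w x. w \<in> pure_words i \<and> x \<in> carrier_vec d}" for i
  \<comment> \<open>Vectors killed by all coefficients lie in no \<open>R i\<close>; assigning them to index \<open>0\<close> makes the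
    subspaces span the whole space.\<close>
  define G where "G i = (if i = 0 then {x \<in> carrier_vec d. \<forall>j w f. 0 < j \<and> w \<in> pure_words j \<longrightarrow>
    adj_if f (p w) *\<^sub>v x = 0\<^sub>v d} else R i)" for i
  have RG: "R i \<subseteq> G i" for i
    using orth opv by (fastforce simp: G_def R_def)
  have Gc: "G i \<subseteq> carrier_vec d" for i using opv by (auto simp: G_def R_def)
  have kill: "adj_if f (p w) *\<^sub>v x = 0\<^sub>v d"
    if "x \<in> G i" "w \<in> pure_words j" "j \<noteq> i" "j \<noteq> 0" for x i w j f
    using that orth by (cases "i = 0") (auto simp: G_def R_def)
  \<comment> \<open>For \<open>j\<close> other than 0 the vector \<open>y\<close> is a value of a
    coefficient or adjoint of index \<open>j\<close>. Moved to the other side of the inner product,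
    that matrix kills \<open>x\<close>.\<close>
  have GG': "x \<bullet>c y = 0" if h: "i \<noteq> j" "j \<noteq> 0" "x \<in> G i" "y \<in> G j" for i j x y
  proof -
    obtain f w z where y: "y = adj_if f (p w) *\<^sub>v z" "w \<in> pure_words j" "z \<in> carrier_vec d"
      using h(2,4) by (auto simp: G_def R_def)
    have x: "x \<in> carrier_vec d" using h(3) Gc by auto
    have "adj_if (\<not> f) (p w) *\<^sub>v x = 0\<^sub>v d" using kill[OF h(3) y(2)] h by auto
    moreover have "x \<bullet>c y = (adj_if (\<not> f) (p w) *\<^sub>v x) \<bullet>c z"
      using cscalar_prod_adjoint[OF opc x y(3), of "\<not> f" w] by (simp add: adjoint_adj_if y(1))
    ultimately show ?thesis using y(3) by simp
  qed
  have GG: "x \<bullet>c y = 0" if "i \<noteq> j" "x \<in> G i" "y \<in> G j" for i j x y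
  proof (cases "j = 0")
    case True
    then have "y \<bullet>c x = 0" using GG'[of j i y x] that by auto
    then show ?thesis using cscalar_prod_eq_0_swap[of x d y] that Gc by auto
  qed (use GG'[of i j x y] that in auto)
  have total: "x = 0\<^sub>v d"
    if x: "x \<in> carrier_vec d" and perp: "\<And>i z. i < g \<Longrightarrow> z \<in> G i \<Longrightarrow> z \<bullet>c x = 0" for x
  proof -
    have "adj_if f (p w) *\<^sub>v x = 0\<^sub>v d" if "0 < j" "w \<in> pure_words j" for j w f
    proof (cases "j < g")
      case True
      let ?y = "adj_if f (p w) *\<^sub>v x"
      \<comment> \<open>With \<open>A\<close> for the coefficient or its adjoint,
        \<open>A^* A x\<close> lies in \<open>R j\<close>, hence is orthogonal to \<open>x\<close>;
        so the norm of \<open>A x\<close> is zero. Thus \<open>x\<close> belongs to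
        \<open>G 0\<close> and is orthogonal to itself.\<close>
      have "adj_if (\<not> f) (p w) *\<^sub>v ?y \<in> R j"
        unfolding R_def using that opv[OF x, of f w] by blast
      then have "(adj_if (\<not> f) (p w) *\<^sub>v ?y) \<bullet>c x = 0" using perp[OF True] RG by auto
      then have "?y \<bullet>c ?y = 0"
        using cscalar_prod_adjoint[OF opc opv[OF x] x, of "\<not> f" w f w] by (simp add: adjoint_adj_if)
      then show ?thesis using conjugate_square_eq_0_vec[OF opv[OF x]] by blast
    next
      case False
      have "w \<notin> words_in {..<g}"
        using False that by (cases w) (auto simp: pure_words_def words_in_def)
      then have "p w = 0\<^sub>m d d" using free by (auto simp: free_mat_poly_def poly_support_def)
      then show ?thesis using x by (simp add: adj_if_def zero_mat_mult_vec)
    qed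
    then have "x \<in> G 0" using x by (auto simp: G_def)
    then have "x \<bullet>c x = 0" using perp g by auto
    then show ?thesis using conjugate_square_eq_0_vec[OF x] by blast
  qed
  obtain L where L: "distinct (concat (map L [0..<g]))" "length (concat (map L [0..<g])) = d"
    "orthonormal d (set (concat (map L [0..<g])))"
    "\<And>i j z u. i < g \<Longrightarrow> j < g \<Longrightarrow> i \<noteq> j \<Longrightarrow> z \<in> G j \<Longrightarrow> u \<in> set (L i) \<Longrightarrow> z \<bullet>c u = 0"
    "\<And>i j u v. i < g \<Longrightarrow> j < g \<Longrightarrow> i \<noteq> j \<Longrightarrow> u \<in> set (L i) \<Longrightarrow> v \<in> set (L j) \<Longrightarrow> u \<bullet>c v = 0"
  proof (rule adapted_orthonormal_basis[of g G d], goal_cases)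
    case (1 i)
    show ?case by (rule Gc)
  next
    case (2 i j x y)
    from 2(4-) show ?case by (rule GG)
  next
    case (3 x)
    from 3(2-) show ?case by (rule total)
  next
    case (4 L)
    from 4(2-) show ?case by (rule that)
  qed
  define us where "us = concat (map L [0..<g])"
  have usc: "set us \<subseteq> carrier_vec d" using L(3) by (simp add: orthonormal_def us_def)
  have Lc: "set (L i) \<subseteq> carrier_vec d" if "i < g" for i
  proof -
    have "set (L i) \<subseteq> set us" using that by (auto simp: us_def)
    then show ?thesis using usc by blast
  qed
  have range: "p w *\<^sub>v x \<in> G m" "mat_adjoint (p w) *\<^sub>v x \<in> G m"
    if "w \<in> pure_words m" "x \<in> carrier_vec d" for w m x
  proof -
    have "adj_if f (p w) *\<^sub>v x \<in> G m" for f using RG that by (fastforce simp: R_def)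
    from this[of False] this[of True] show "p w *\<^sub>v x \<in> G m" "mat_adjoint (p w) *\<^sub>v x \<in> G m"
      by (simp_all add: adj_if_def)
  qed
  have off: "(p w *\<^sub>v y) \<bullet>c x = 0" if "i < g" "j < g" "i \<noteq> j" "x \<in> set (L i)" "y \<in> set (L j)" for i j x y w
  proof -
    have c: "x \<in> carrier_vec d" "y \<in> carrier_vec d" using that Lc by auto
    consider "p w = 0\<^sub>m d d" | "w = []" | m where "m < g" "w \<in> pure_words m" using words by blast
    then show ?thesis
    proof cases
      case 1
      then show ?thesis using c by (simp add: zero_mat_mult_vec)
    next
      \<comment> \<open>Here \<open>p\<close> being monic enters: the identity is diagonal in every
        orthonormal basis.\<close>
      case 2
      then have "p w *\<^sub>v y = y" using monic c by (simp add: monic_poly_def)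
      then show ?thesis using L(5)[of j i y x] that by simp
    next
      case 3
      show ?thesis
      \<comment> \<open>If \<open>m\<close> differs from \<open>i\<close>, the value
        \<open>p w *\<^sub>v y\<close> in \<open>G m\<close> is orthogonal to \<open>x\<close>. If
        \<open>m = i\<close>, then \<open>y\<close> is the vector outside block \<open>m\<close>,
        and the coefficient is moved to \<open>x\<close> as an adjoint.\<close>
      proof (cases "m = i")
        case True
        have "(mat_adjoint (p w) *\<^sub>v x) \<bullet>c y = 0"
          using L(4)[of j m _ y] range(2)[OF 3(2) c(1)] 3 that True by auto
        moreover have "mat_adjoint (p w) *\<^sub>v x \<in> carrier_vec d"
          using range(2)[OF 3(2) c(1)] Gc by auto
        ultimately have "y \<bullet>c (mat_adjoint (p w) *\<^sub>v x) = 0"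
          using cscalar_prod_eq_0_swap[OF c(2)] by blast
        then show ?thesis using cscalar_prod_adjoint[OF pc c(2,1)] by simp
      next
        case False
        then show ?thesis using L(4)[of i m _ x] range(1)[OF 3(2) c(2)] 3 that by auto
      qed
    qed
  qed
  \<comment> \<open>The cut-off makes \<open>q i\<close> a polynomial in the variable
    \<open>i\<close> by construction; \<open>gram_q\<close> shows that it discards only zeros. The
    empty word passes for every \<open>i\<close>, so each block keeps its own identity.\<close>
  define q where "q i w = (if w \<in> words_in {i} then gram (L i) (p w) else 0\<^sub>m (length (L i)) (length (L i)))" for i w
  have gram_q: "gram (L i) (p w) = q i w" if i: "i < g" for i w
  proof (cases "w \<in> words_in {i}")
    case False
    then have "w \<noteq> []" by (auto simp: words_in_def)
    consider "p w = 0\<^sub>m d d" | m where "m < g" "w \<in> pure_words m" using words \<open>w \<noteq> []\<close> by blast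
    then have "gram (L i) (p w) = 0\<^sub>m (length (L i)) (length (L i))"
    proof cases
      case 1
      then show ?thesis using gram_zero[OF Lc[OF i]] by simp
    next
      case 2
      then have m: "m \<noteq> i" using False by (auto simp: pure_words_def words_in_def)
      show ?thesis
      proof (rule eq_matI)
        fix r s assume "r < dim_row (0\<^sub>m (length (L i)) (length (L i)))"
          "s < dim_col (0\<^sub>m (length (L i)) (length (L i)))"
        then have rs: "r < length (L i)" "s < length (L i)" by auto
        then have mem: "L i ! r \<in> set (L i)" "L i ! s \<in> carrier_vec d" using Lc[OF i] nth_mem by auto
        have "(p w *\<^sub>v L i ! s) \<bullet>c (L i ! r) = 0"
          using L(4)[of i m] range(1)[OF 2(2) mem(2)] mem(1) i 2 m by auto
        then show "gram (L i) (p w) $$ (r, s) = 0\<^sub>m (length (L i)) (length (L i)) $$ (r, s)"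
          using rs by (simp add: gram_def)
      qed auto
    qed
    then show ?thesis using False by (simp add: q_def)
  qed (simp add: q_def)
  show thesis
  proof (rule that)
    show "unitary_mat d (mat_of_cols d us)"
      unfolding us_def by (rule unitary_mat_of_cols[OF L(1,3,2)])
    show "(\<Sum>i<g. length (L i)) = d"
      using L(2) by (simp add: length_concat comp_def sum_list_distinct_conv_sum_set atLeast0LessThan)
    show "poly_conj (mat_of_cols d us) p = poly_direct_sum g q"
    proof
      fix w
      have "poly_conj (mat_of_cols d us) p w = gram us (p w)"
        unfolding poly_conj_def by (rule gram_conv_mult[OF usc pc])
      also have "\<dots> = diag_block_mat (map (\<lambda>i. gram (L i) (p w)) [0..<g])"
        unfolding us_def by (rule gram_concat) (use off in auto)
      also have "\<dots> = poly_direct_sum g q w"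
        unfolding poly_direct_sum_def by (intro arg_cong[of _ _ diag_block_mat] map_cong refl gram_q) auto
      finally show "poly_conj (mat_of_cols d us) p w = poly_direct_sum g q w" .
    qed
    show "free_mat_poly {i} (length (L i)) (q i)" if i: "i < g" for i
      unfolding free_mat_poly_def
    proof (intro conjI allI)
      show "q i w \<in> carrier_mat (length (L i)) (length (L i))" for w by (simp add: q_def)
      have "poly_support (length (L i)) (q i) \<subseteq> poly_support d p"
      proof
        fix w assume "w \<in> poly_support (length (L i)) (q i)"
        then have "gram (L i) (p w) \<noteq> 0\<^sub>m (length (L i)) (length (L i))"
          using gram_q[OF i] by (simp add: poly_support_def)
        then show "w \<in> poly_support d p" using gram_zero[OF Lc[OF i]] by (auto simp: poly_support_def)
      qed
      then show "finite (poly_support (length (L i)) (q i))"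
        using finite_support[OF free inv] finite_subset by blast
      show "poly_support (length (L i)) (q i) \<subseteq> words_in {i}"
        by (auto simp: poly_support_def q_def)
    qed
  qed
qed

section \<open>The converse: an explicit unitary\<close>

lemma diag_block_mat_carrier:
  assumes "\<And>i. i \<in> set js \<Longrightarrow> A i \<in> carrier_mat (e i) (e i)"
  shows "diag_block_mat (map A js) \<in> carrier_mat (\<Sum>i\<leftarrow>js. e i) (\<Sum>i\<leftarrow>js. e i)"
proof -
  have "map dim_row (map A js) = map e js" "map dim_col (map A js) = map e js"
    using assms by auto
  then show ?thesis by (intro carrier_matI) (simp_all only: dim_diag_block_mat)
qed

text \<open>The index maps depend only on the sizes of the blocks, hence serve all coefficients of a
  polynomial at once: \<open>\<tau>\<close> is the block of an index and \<open>\<rho>\<close> the position within that block.\<close>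

lemma index_diag_block_mat:
  fixes js :: "nat list"
  assumes "distinct js"
  obtains \<tau> \<rho> where "\<And>x. x < (\<Sum>i\<leftarrow>js. e i) \<Longrightarrow> \<tau> x \<in> set js \<and> \<rho> x < e (\<tau> x)"
    "\<And>A x y. (\<And>i. i \<in> set js \<Longrightarrow> A i \<in> carrier_mat (e i) (e i)) \<Longrightarrow>
      x < (\<Sum>i\<leftarrow>js. e i) \<Longrightarrow> y < (\<Sum>i\<leftarrow>js. e i) \<Longrightarrow>
      diag_block_mat (map A js) $$ (x, y) = (if \<tau> x = \<tau> y then A (\<tau> x) $$ (\<rho> x, \<rho> y) else (0 :: complex))"
  using assms
proof (induction js arbitrary: thesis)
  case Nil
  show ?case by (rule Nil(1)) auto
next
  case (Cons j js)
  obtain \<tau> \<rho> where IH: "\<And>x. x < (\<Sum>i\<leftarrow>js. e i) \<Longrightarrow> \<tau> x \<in> set js \<and> \<rho> x < e (\<tau> x)"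
    "\<And>A x y. (\<And>i. i \<in> set js \<Longrightarrow> A i \<in> carrier_mat (e i) (e i)) \<Longrightarrow>
      x < (\<Sum>i\<leftarrow>js. e i) \<Longrightarrow> y < (\<Sum>i\<leftarrow>js. e i) \<Longrightarrow>
      diag_block_mat (map A js) $$ (x, y) = (if \<tau> x = \<tau> y then A (\<tau> x) $$ (\<rho> x, \<rho> y) else (0 :: complex))"
  proof (rule Cons.IH, goal_cases)
    case (1 \<tau> \<rho>)
    from 1(2-) show ?case by (rule that)
  qed (use Cons.prems(2) in simp)
  define \<tau>' where "\<tau>' x = (if x < e j then j else \<tau> (x - e j))" for x
  define \<rho>' where "\<rho>' x = (if x < e j then x else \<rho> (x - e j))" for x
  show ?case
  proof (rule Cons.prems(1))
    show "\<tau>' x \<in> set (j # js) \<and> \<rho>' x < e (\<tau>' x)" if "x < (\<Sum>i\<leftarrow>j # js. e i)" for x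
      using that IH(1)[of "x - e j"] by (auto simp: \<tau>'_def \<rho>'_def)
    fix A :: "nat \<Rightarrow> complex mat" and x y
    assume A: "\<And>i. i \<in> set (j # js) \<Longrightarrow> A i \<in> carrier_mat (e i) (e i)"
      and x: "x < (\<Sum>i\<leftarrow>j # js. e i)" and y: "y < (\<Sum>i\<leftarrow>j # js. e i)"
    have Aj: "dim_row (A j) = e j" "dim_col (A j) = e j" using A[of j] by auto
    have D: "dim_row (diag_block_mat (map A js)) = (\<Sum>i\<leftarrow>js. e i)"
      "dim_col (diag_block_mat (map A js)) = (\<Sum>i\<leftarrow>js. e i)"
      using diag_block_mat_carrier[of js A e] A by auto
    \<comment> \<open>As \<open>j\<close> does not occur in \<open>js\<close>, an index beyond the
      first block is never attributed to \<open>j\<close>, so equal values of \<open>\<tau>'\<close>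
      mean the same block.\<close>
    have ne: "\<tau> (z - e j) \<noteq> j" if "z < (\<Sum>i\<leftarrow>j # js. e i)" "\<not> z < e j" for z
    proof -
      have "z - e j < (\<Sum>i\<leftarrow>js. e i)" using that by (simp add: not_less less_diff_conv2)
      then show ?thesis using IH(1)[of "z - e j"] Cons.prems(2) by auto
    qed
    have IH2: "diag_block_mat (map A js) $$ (x - e j, y - e j) =
        (if \<tau> (x - e j) = \<tau> (y - e j) then A (\<tau> (x - e j)) $$ (\<rho> (x - e j), \<rho> (y - e j)) else 0)"
      if "\<not> x < e j" "\<not> y < e j"
      by (rule IH(2)) (use that A x y in auto)
    show "diag_block_mat (map A (j # js)) $$ (x, y) =
        (if \<tau>' x = \<tau>' y then A (\<tau>' x) $$ (\<rho>' x, \<rho>' y) else 0)"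
      using x y ne[of x] ne[of y] IH2
      by (auto simp: Let_def Aj D \<tau>'_def \<rho>'_def)
  qed
qed

text \<open>The direct sum of \<open>u 0\<close> to \<open>u (d - 1)\<close>, laid out as in
  \<open>kron\<close>: it acts on the \<open>n\<close> coordinates over \<open>a\<close> by a matrix
  of their own, and for constant \<open>u\<close> it is \<open>kron (1\<^sub>m d) u\<close>.\<close>

definition block_diag :: "nat \<Rightarrow> nat \<Rightarrow> (nat \<Rightarrow> complex mat) \<Rightarrow> complex mat" where
  "block_diag d n u = mat (d * n) (d * n) (\<lambda>(x, y).
     if x div n = y div n then u (x div n) $$ (x mod n, y mod n) else 0)"

lemma block_diag_carrier [simp]: "block_diag d n u \<in> carrier_mat (d * n) (d * n)"
  by (simp add: block_diag_def)

lemma index_block_diag: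
  assumes "a < d" "r < n" "b < d" "s < n"
  shows "block_diag d n u $$ (a * n + r, b * n + s) = (if a = b then u a $$ (r, s) else 0)"
  using assms by (simp add: block_diag_def block_index_less)

text \<open>Block \<open>(a, b)\<close> meets only \<open>u a\<close> on the left and
  \<open>u b\<close> on the right. When \<open>u a = u b\<close>, the factor \<open>B\<close> is
  simply conjugated, which is the case wherever \<open>A\<close> is nonzero in the
  application.\<close>

lemma block_diag_conj:
  assumes u: "\<And>a. a < d \<Longrightarrow> u a \<in> carrier_mat n n"
    and A: "A \<in> carrier_mat d d" and B: "B \<in> carrier_mat n n"
    and i: "a < d" "r < n" "b < d" "s < n"
  shows "(mat_adjoint (block_diag d n u) * kron A B * block_diag d n u) $$ (a * n + r, b * n + s) =
    A $$ (a, b) * (mat_adjoint (u a) * B * u b) $$ (r, s)"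
proof -
  let ?D = "block_diag d n u" and ?N = "d * n"
  have D: "mat_adjoint ?D \<in> carrier_mat ?N ?N" "kron A B * ?D \<in> carrier_mat ?N ?N"
    using kron_carrier[OF A B] by (auto intro!: mult_carrier_mat[of _ ?N ?N])
  have Da: "mat_adjoint ?D $$ (a * n + r, c * n + t) = (if c = a then cnj (u a $$ (t, r)) else 0)"
    if "c < d" "t < n" for c t
    using that i index_block_diag[of c d t n a r u] carrier_matD[OF block_diag_carrier[of d n u]]
    by (simp add: block_index_less)
  have uab: "mat_adjoint (u a) \<in> carrier_mat n n" "B * u b \<in> carrier_mat n n"
    using u i B by (auto intro!: mult_carrier_mat[of _ n n])
  have right: "(kron A B * ?D) $$ (a * n + t, b * n + s) = A $$ (a, b) * (B * u b) $$ (t, s)" if t: "t < n" for t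
  proof -
    have "(kron A B * ?D) $$ (a * n + t, b * n + s) =
        (\<Sum>c<d. \<Sum>t'<n. kron A B $$ (a * n + t, c * n + t') * ?D $$ (c * n + t', b * n + s))"
      unfolding index_mult_mat_sum[OF kron_carrier[OF A B] block_diag_carrier
          block_index_less[OF i(1) t] block_index_less[OF i(3,4)]] by (rule sum_block)
    also have "\<dots> = (\<Sum>c<d. if c = b then (\<Sum>t'<n. A $$ (a, b) * (B $$ (t, t') * u b $$ (t', s))) else 0)"
      using i t by (intro sum.cong refl) (auto simp: index_kron[OF A B] index_block_diag mult.assoc)
    also have "\<dots> = A $$ (a, b) * (B * u b) $$ (t, s)"
      using i by (simp add: sum_distrib_left index_mult_mat_sum[OF B u[OF i(3)] t i(4)] del: index_mult_mat)
    finally show ?thesis .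
  qed
  have "(mat_adjoint ?D * kron A B * ?D) $$ (a * n + r, b * n + s) =
      (mat_adjoint ?D * (kron A B * ?D)) $$ (a * n + r, b * n + s)"
    using assoc_mult_mat[OF D(1) kron_carrier[OF A B] block_diag_carrier] by simp
  also have "\<dots> = (\<Sum>c<d. \<Sum>t<n. mat_adjoint ?D $$ (a * n + r, c * n + t) * (kron A B * ?D) $$ (c * n + t, b * n + s))"
    unfolding index_mult_mat_sum[OF D block_index_less[OF i(1,2)] block_index_less[OF i(3,4)]]
    by (rule sum_block)
  also have "\<dots> = (\<Sum>c<d. if c = a then (\<Sum>t<n. cnj (u a $$ (t, r)) * (kron A B * ?D) $$ (a * n + t, b * n + s)) else 0)"
    by (intro sum.cong refl) (auto simp: Da simp del: index_mult_mat)
  also have "\<dots> = (\<Sum>t<n. A $$ (a, b) * (mat_adjoint (u a) $$ (r, t) * (B * u b) $$ (t, s)))"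
    using i u[OF i(1)] by (simp add: right mult_ac del: index_mult_mat)
  also have "\<dots> = A $$ (a, b) * (mat_adjoint (u a) * (B * u b)) $$ (r, s)"
    by (simp add: index_mult_mat_sum[OF uab i(2,4)] sum_distrib_left del: index_mult_mat)
  also have "mat_adjoint (u a) * (B * u b) = mat_adjoint (u a) * B * u b"
    using assoc_mult_mat[OF uab(1) B u[OF i(3)]] by simp
  finally show ?thesis .
qed

lemma unitary_block_diag:
  assumes u: "\<And>a. a < d \<Longrightarrow> unitary_mat n (u a)"
  shows "unitary_mat (d * n) (block_diag d n u)"
proof -
  let ?D = "block_diag d n u" and ?N = "d * n"
  have uc: "u a \<in> carrier_mat n n" if "a < d" for a using u[OF that] by (simp add: unitary_mat_def)
  have D: "mat_adjoint ?D \<in> carrier_mat ?N ?N" by simp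
  have "mat_adjoint ?D * kron (1\<^sub>m d) (1\<^sub>m n) * ?D = 1\<^sub>m ?N"
  proof (rule block_mat_eqI)
    show "mat_adjoint ?D * kron (1\<^sub>m d) (1\<^sub>m n) * ?D \<in> carrier_mat ?N ?N"
      unfolding kron_one by (intro mult_carrier_mat[of _ ?N ?N]) auto
    fix a r b s assume i: "a < d" "r < n" "b < d" "s < n"
    have "(mat_adjoint ?D * kron (1\<^sub>m d) (1\<^sub>m n) * ?D) $$ (a * n + r, b * n + s) =
        1\<^sub>m d $$ (a, b) * (mat_adjoint (u a) * 1\<^sub>m n * u b) $$ (r, s)"
      by (rule block_diag_conj[OF uc]) (use i in auto)
    also have "mat_adjoint (u a) * 1\<^sub>m n = mat_adjoint (u a)"
      by (rule right_mult_one_mat[of _ n n]) (use uc[OF i(1)] in simp)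
    also have "1\<^sub>m d $$ (a, b) * (mat_adjoint (u a) * u b) $$ (r, s) = 1\<^sub>m ?N $$ (a * n + r, b * n + s)"
      using u[OF i(1)] i by (auto simp: unitary_mat_def block_index_less block_index_eq_iff simp del: index_mult_mat)
    finally show "(mat_adjoint ?D * kron (1\<^sub>m d) (1\<^sub>m n) * ?D) $$ (a * n + r, b * n + s) =
        1\<^sub>m ?N $$ (a * n + r, b * n + s)" .
  qed simp
  then have "mat_adjoint ?D * ?D = 1\<^sub>m ?N"
    using right_mult_one_mat[OF D] by (simp add: kron_one)
  then show ?thesis
    unfolding unitary_mat_def using mat_mult_left_right_inverse[OF D block_diag_carrier] by simp
qed

text \<open>Between consecutive letters \<open>U * mat_adjoint U\<close> cancels; this requires all
  letters to be conjugated by the same unitary, hence words in one variable.\<close>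

lemma word_eval_conj:
  assumes U: "unitary_mat n U" and X: "X \<in> carrier_mat n n"
    and "\<And>l. l \<in> set w \<Longrightarrow> Z (letter_index l) = X \<and> Y (letter_index l) = mat_adjoint U * X * U"
  shows "word_eval n Y w = mat_adjoint U * word_eval n Z w * U"
  using assms(3)
proof (induction w)
  case Nil
  have "mat_adjoint U * 1\<^sub>m n = mat_adjoint U"
    by (rule right_mult_one_mat[of _ n n]) (use U in \<open>simp add: unitary_mat_def\<close>)
  then show ?case using U by (simp add: unitary_mat_def)
next
  case (Cons l w)
  have Uc: "U \<in> carrier_mat n n" using U by (simp add: unitary_mat_def)
  have Z: "letter_eval Z l \<in> carrier_mat n n" "word_eval n Z w \<in> carrier_mat n n"
    using X Cons.prems by (auto intro!: letter_eval_carrier word_eval_carrier)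
  have "letter_eval Y l = mat_adjoint U * letter_eval Z l * U"
  proof (cases l)
    case (Adj i)
    then show ?thesis using adj_if_conj[OF Uc X, of True] Cons.prems[of l] by (simp add: adj_if_def)
  qed (use Cons.prems[of l] in simp)
  then show ?case
    using Cons unitary_conj_cancel[OF U Z] by simp
qed

text \<open>In the basis of \<open>V\<close>, a coefficient of \<open>w\<close> is nonzero at
  \<open>(a, b)\<close> only if both indices lie in the block of the one variable that
  \<open>w\<close> may contain. Then the same unitary acts on both sides and conjugates the value of
  \<open>w\<close>; other entries are zero anyway. So the relation holds word by word.\<close>

lemma decomposable_imp_invariant:
  fixes g d :: nat and p :: free_poly
  assumes free: "free_mat_poly {..<g} d p" and V: "unitary_mat d V"
    and q: "\<And>i. i < g \<Longrightarrow> free_mat_poly {i} (e i) (q i)" and e: "(\<Sum>i<g. e i) = d"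
    and eq: "poly_conj V p = poly_direct_sum g q"
  shows "coord_unitary_invariant g d p"
  unfolding coord_unitary_invariant_def
proof (intro allI impI)
  fix n and U :: "nat \<Rightarrow> complex mat"
  assume "\<forall>i<g. unitary_mat n (U i)"
  then have U: "unitary_mat n (U i)" "U i \<in> carrier_mat n n" if "i < g" for i
    using that by (auto simp: unitary_mat_def)
  let ?N = "d * n"
  have pc: "p w \<in> carrier_mat d d" for w using free by (simp add: free_mat_poly_def)
  have Vc: "V \<in> carrier_mat d d" using V by (simp add: unitary_mat_def)
  have sum: "(\<Sum>i\<leftarrow>[0..<g]. e i) = d"
    using e by (simp add: sum_list_distinct_conv_sum_set atLeast0LessThan)
  have qc: "q i w \<in> carrier_mat (e i) (e i)" if "i \<in> set [0..<g]" for i w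
    using q[of i] that by (simp add: free_mat_poly_def)
  obtain \<tau> \<rho> where \<tau>: "\<And>x. x < d \<Longrightarrow> \<tau> x \<in> set [0..<g] \<and> \<rho> x < e (\<tau> x)"
    and idx: "\<And>A x y. (\<And>i. i \<in> set [0..<g] \<Longrightarrow> A i \<in> carrier_mat (e i) (e i)) \<Longrightarrow> x < d \<Longrightarrow> y < d \<Longrightarrow>
      diag_block_mat (map A [0..<g]) $$ (x, y) = (if \<tau> x = \<tau> y then A (\<tau> x) $$ (\<rho> x, \<rho> y) else (0 :: complex))"
  proof (rule index_diag_block_mat[of "[0..<g]" e, unfolded sum], goal_cases)
    case (2 \<tau> \<rho>)
    from 2(2-) show ?case by (rule that)
  qed simp
  have \<tau>g: "\<tau> a < g" if "a < d" for a using \<tau>[OF that] by simp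
  define Q where "Q w = poly_conj V p w" for w
  have Qc: "Q w \<in> carrier_mat d d" for w
    using Vc pc by (auto simp: Q_def poly_conj_def intro!: mult_carrier_mat[of _ d d])
  have Qe: "\<tau> a = \<tau> b \<and> w \<in> words_in {\<tau> a}" if "a < d" "b < d" "Q w $$ (a, b) \<noteq> 0" for a b w
  proof -
    have "Q w $$ (a, b) = (if \<tau> a = \<tau> b then q (\<tau> a) w $$ (\<rho> a, \<rho> b) else 0)"
      unfolding Q_def eq poly_direct_sum_def by (rule idx) (use qc that in auto)
    then have "\<tau> a = \<tau> b" "q (\<tau> a) w $$ (\<rho> a, \<rho> b) \<noteq> 0" using that(3) by (auto split: if_splits)
    then have "w \<in> poly_support (e (\<tau> a)) (q (\<tau> a))"
      using \<tau>[OF that(1)] \<tau>[OF that(2)] by (auto simp: poly_support_def)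
    then show ?thesis using q[OF \<tau>g[OF that(1)]] \<open>\<tau> a = \<tau> b\<close> by (auto simp: free_mat_poly_def)
  qed
  define T where "T = kron V (1\<^sub>m n)"
  \<comment> \<open>Over the coordinate \<open>a\<close> acts the unitary of the variable that owns
    the block of \<open>a\<close>.\<close>
  define D where "D = block_diag d n (\<lambda>a. U (\<tau> a))"
  have T: "unitary_mat ?N (mat_adjoint T)" "T \<in> carrier_mat ?N ?N" "mat_adjoint T \<in> carrier_mat ?N ?N"
    using unitary_kron[OF V unitary_mat_one, of n] unitary_mat_adjoint[of ?N T]
    by (auto simp: T_def unitary_mat_def)
  have T_sandwich: "T * A * mat_adjoint T * (T * B * mat_adjoint T) = T * (A * B) * mat_adjoint T"
    if "A \<in> carrier_mat ?N ?N" "B \<in> carrier_mat ?N ?N" for A B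
    using unitary_conj_cancel[OF T(1) that] by simp
  have D: "unitary_mat ?N D" "D \<in> carrier_mat ?N ?N" "mat_adjoint D \<in> carrier_mat ?N ?N"
    using unitary_block_diag[of d n "\<lambda>a. U (\<tau> a)"] U \<tau>g by (auto simp: D_def)
  \<comment> \<open>\<open>D\<close> is the intertwiner for the block form \<open>Q\<close>;
    conjugation by \<open>T\<close> carries it back to \<open>p\<close>.\<close>
  define W where "W = T * D * mat_adjoint T"
  have W: "unitary_mat ?N W"
    unfolding W_def using T D unitary_mat_adjoint[OF T(1)] by (intro unitary_mat_mult) auto
  have Wc: "W \<in> carrier_mat ?N ?N" using W by (simp add: unitary_mat_def)
  have Wa: "mat_adjoint W = T * mat_adjoint D * mat_adjoint T"
    using adj_if_conj[OF T(3) D(2), of True] by (simp add: W_def adj_if_def)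
  have pQ: "kron (p w) M = T * kron (Q w) M * mat_adjoint T" if M: "M \<in> carrier_mat n n" for w M
  proof -
    have "p w = V * Q w * mat_adjoint V"
      using unitary_conj_inverse[OF V pc[of w]] by (simp add: Q_def poly_conj_def)
    moreover have "T * kron (Q w) M = kron (V * Q w) M"
      using kron_mult[OF Vc one_carrier_mat Qc[of w] M] M by (simp add: T_def)
    moreover have "kron (V * Q w) M * mat_adjoint T = kron (V * Q w * mat_adjoint V) M"
      using kron_mult[of "V * Q w" d d M n n "mat_adjoint V" d "1\<^sub>m n" n] Vc Qc[of w] M
      by (simp add: T_def kron_adjoint[OF Vc one_carrier_mat] mult_carrier_mat[of _ d d])
    ultimately show ?thesis by simp
  qed
  show "\<exists>W. unitary_mat ?N W \<and> (\<forall>X. (\<forall>i<g. X i \<in> carrier_mat n n) \<longrightarrow>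
      poly_eval d n p (\<lambda>i. mat_adjoint (U i) * X i * U i) = mat_adjoint W * poly_eval d n p X * W)"
  proof (intro exI[of _ W] conjI allI impI W)
    fix X :: "nat \<Rightarrow> complex mat" assume "\<forall>i<g. X i \<in> carrier_mat n n"
    then have X: "X i \<in> carrier_mat n n" if "i < g" for i using that by blast
    let ?Y = "\<lambda>i. mat_adjoint (U i) * X i * U i" and ?S = "poly_support d p"
    have Y: "?Y i \<in> carrier_mat n n" if "i < g" for i
      using X[OF that] U(2)[OF that] by (auto intro!: mult_carrier_mat[of _ n n])
    have S: "finite ?S" "\<And>w l. w \<in> ?S \<Longrightarrow> l \<in> set w \<Longrightarrow> letter_index l < g"
      using free by (auto simp: free_mat_poly_def words_in_def)
    have wX: "word_eval n X w \<in> carrier_mat n n" and wY: "word_eval n ?Y w \<in> carrier_mat n n"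
      if "w \<in> ?S" for w
      using S(2)[OF that] X Y by (auto intro!: word_eval_carrier)
    have word: "mat_adjoint W * kron (p w) (word_eval n X w) * W = kron (p w) (word_eval n ?Y w)"
      if w: "w \<in> ?S" for w
    proof -
      have k: "kron (Q w) (word_eval n X w) \<in> carrier_mat ?N ?N" using Qc wX[OF w] by simp
      have "mat_adjoint D * kron (Q w) (word_eval n X w) * D = kron (Q w) (word_eval n ?Y w)"
      proof (rule block_mat_eqI)
        show "mat_adjoint D * kron (Q w) (word_eval n X w) * D \<in> carrier_mat ?N ?N"
          using D k by (intro mult_carrier_mat)
        show "kron (Q w) (word_eval n ?Y w) \<in> carrier_mat ?N ?N" using Qc wY[OF w] by simp
        fix a r b s assume i: "a < d" "r < n" "b < d" "s < n"
        have "(mat_adjoint D * kron (Q w) (word_eval n X w) * D) $$ (a * n + r, b * n + s) =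
            Q w $$ (a, b) * (mat_adjoint (U (\<tau> a)) * word_eval n X w * U (\<tau> b)) $$ (r, s)"
          unfolding D_def by (rule block_diag_conj[OF _ Qc wX[OF w] i]) (use U \<tau>g in auto)
        also have "\<dots> = Q w $$ (a, b) * word_eval n ?Y w $$ (r, s)"
        proof (cases "Q w $$ (a, b) = 0")
          case False
          have t: "\<tau> a = \<tau> b" "w \<in> words_in {\<tau> a}" using Qe[OF i(1,3) False] by auto
          have "word_eval n ?Y w = mat_adjoint (U (\<tau> a)) * word_eval n X w * U (\<tau> a)"
            by (rule word_eval_conj[OF U(1)[OF \<tau>g[OF i(1)]] X[OF \<tau>g[OF i(1)]]])
              (use t in \<open>auto simp: words_in_def\<close>)
          then show ?thesis using t(1) by simp
        qed simp
        also have "\<dots> = kron (Q w) (word_eval n ?Y w) $$ (a * n + r, b * n + s)"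
          using index_kron[OF Qc wY[OF w] i] by simp
        finally show "(mat_adjoint D * kron (Q w) (word_eval n X w) * D) $$ (a * n + r, b * n + s) =
            kron (Q w) (word_eval n ?Y w) $$ (a * n + r, b * n + s)" .
      qed
      moreover have "mat_adjoint W * kron (p w) (word_eval n X w) * W =
          T * (mat_adjoint D * kron (Q w) (word_eval n X w) * D) * mat_adjoint T"
        by (subst Wa, subst W_def, subst pQ[OF wX[OF w]], subst T_sandwich[OF D(3) k])
          (rule T_sandwich[OF mult_carrier_mat[OF D(3) k] D(2)])
      ultimately show ?thesis using pQ[OF wY[OF w]] by simp
    qed
    have ke: "kron (p w) (word_eval n X w) \<in> carrier_mat ?N ?N" if "w \<in> ?S" for w
      using pc wX[OF that] by simp
    show "poly_eval d n p ?Y = mat_adjoint W * poly_eval d n p X * W"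
    proof (rule eq_matI)
      fix x y assume "x < dim_row (mat_adjoint W * poly_eval d n p X * W)"
        "y < dim_col (mat_adjoint W * poly_eval d n p X * W)"
      then have xy: "x < ?N" "y < ?N" using Wc by auto
      have "(mat_adjoint W * poly_eval d n p X * W) $$ (x, y) =
          (\<Sum>w\<in>?S. (mat_adjoint W * kron (p w) (word_eval n X w) * W) $$ (x, y))"
        by (rule index_mult_sum_mult[OF _ Wc poly_eval_carrier ke index_poly_eval xy])
          (use Wc S(1) wX in auto)
      also have "\<dots> = (\<Sum>w\<in>?S. kron (p w) (word_eval n ?Y w) $$ (x, y))"
        by (intro sum.cong refl) (simp add: word del: index_mult_mat)
      also have "\<dots> = poly_eval d n p ?Y $$ (x, y)"
        using index_poly_eval[of ?S d p x n y ?Y] S(1) xy wY by simp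
      finally show "poly_eval d n p ?Y $$ (x, y) = (mat_adjoint W * poly_eval d n p X * W) $$ (x, y)" by simp
    qed (use Wc in \<open>auto simp: poly_eval_def\<close>)
  qed
qed

theorem theorem1p2:
  fixes g d :: nat and p :: free_poly
  assumes "g \<ge> 1"
    and "free_mat_poly {..<g} d p"
    and "monic_poly d p"
  shows "coord_unitary_invariant g d p \<longleftrightarrow>
    (\<exists>V e q. unitary_mat d V \<and>
       (\<forall>i<g. free_mat_poly {i} (e i) (q i)) \<and>
       (\<Sum>i<g. e i) = d \<and>
       poly_conj V p = poly_direct_sum g q)"
proof
  assume inv: "coord_unitary_invariant g d p"
  show "\<exists>V e q. unitary_mat d V \<and> (\<forall>i<g. free_mat_poly {i} (e i) (q i)) \<and>
      (\<Sum>i<g. e i) = d \<and> poly_conj V p = poly_direct_sum g q"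
    by (rule invariant_imp_decomposable[OF assms inv]) blast
next
  assume "\<exists>V e q. unitary_mat d V \<and> (\<forall>i<g. free_mat_poly {i} (e i) (q i)) \<and>
      (\<Sum>i<g. e i) = d \<and> poly_conj V p = poly_direct_sum g q"
  then show "coord_unitary_invariant g d p"
    using decomposable_imp_invariant[OF assms(2)] by blast
qed

end
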